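(* Let $n\ge1$, let $Q$ be a real quadratic form on $\mathbb{R}^n$, and let $\frac{2n+2}{n}\le p\le q<\infty$. For any $\varepsilon>0$ there exists a $\gamma>0$ such that the following holds: for all $R\ge1$ there exists an $f\in D$ such that $|\{\xi\in\Omega: f(\xi)\neq0\}|\ge\gamma$ and $$\|\mathcal{E}f\|_{L^p((1+\varepsilon)T_R)}\ge(1-\varepsilon)\,\mathcal{C}_q(R)\,\|f\|_{L^q(S)}.$$
   Context: Let $\Omega=[0,1]^n$. $Q$ is an arbitrary quadratic form on $\mathbb{R}^n$ (no restriction on signature or eigenvalues), and $S=\{(\xi,Q(\xi)):\xi\in\Omega\}$. Functions on $S$ are identified with functions on $\Omega$, and $L^q(S)$ means $L^q(\Omega)$ with Lebesgue measure; $|\cdot|$ of a set is Lebesgue measure. The extension operator is $$\mathcal{E}(f)(x,t)=\int_\Omega f(\xi)\,e^{i(x\cdot\xi+tQ(\xi))}\,d\xi,\qquad (x,t)\in\mathbb{R}^n\times\mathbb{R}.$$ $D$ is the set of measurable functions $f:\Omega\to\{0\}\cup\{z\in\mathbb{C}:|z|=1\}$. For $R>0$ put $T_R=\mathbb{R}^n\times[-R,R]\subset\mathbb{R}^{n+1}$; $(1+\varepsilon)T_R$ is its dilate, i.e. $(1+\varepsilon)T_R=T_{(1+\varepsilon)R}$. With $p$ fixed, for $1\le q\le\infty$, $\mathcal{C}_q(R)$ denotes the best (smallest) constant $C$ such that $\|\mathcal{E}f\|_{L^p(T_R)}\le C\|f\|_{L^q(S)}$ for all $f\in D$. *)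

theory Defs
  imports "HOL-Analysis.Analysis"
begin

definition quadratic_form :: "('a::real_vector \<Rightarrow> real) \<Rightarrow> bool" where
  "quadratic_form Q \<longleftrightarrow> (\<exists>B. bilinear B \<and> Q = (\<lambda>x. B x x))"

definition Omega :: "(real^'n) set" where
  "Omega = cbox 0 1"

(* The L^p norm for a finite exponent p > 0, with values in [0,\<infinity>]; the first case is
   needed because powr is not available on ennreal. *)
definition Lp_norm :: "real \<Rightarrow> 'a measure \<Rightarrow> ('a \<Rightarrow> complex) \<Rightarrow> ennreal" where
  "Lp_norm p M f =
     (let I = \<integral>\<^sup>+ x. ennreal (norm (f x) powr p) \<partial>M
      in if I = \<infinity> then \<infinity> else ennreal (enn2real I powr (1 / p)))"

(* A function on the surface S = {(\<xi>, Q \<xi>) | \<xi> \<in> Omega} is identified with a function of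
   \<xi> \<in> Omega and represented by a total function whose values outside Omega are irrelevant;
   L^q(S) is L^q of Omega with Lebesgue measure. *)

definition extension_op ::
    "(real^'n \<Rightarrow> real) \<Rightarrow> (real^'n \<Rightarrow> complex) \<Rightarrow> (real^'n) \<times> real \<Rightarrow> complex" where
  "extension_op Q f = (\<lambda>(x, t).
     LINT \<xi>|lebesgue_on Omega. f \<xi> * exp (\<i> * complex_of_real (x \<bullet> \<xi> + t * Q \<xi>)))"

definition D :: "(real^'n \<Rightarrow> complex) set" where
  "D = {f. f \<in> borel_measurable (lebesgue_on Omega) \<and> (\<forall>\<xi>\<in>Omega. f \<xi> = 0 \<or> norm (f \<xi>) = 1)}"

definition T :: "real \<Rightarrow> ((real^'n) \<times> real) set" where
  "T R = UNIV \<times> {-R..R}"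

(* The smallest constant C in [0,\<infinity>]; the value \<infinity> means that no finite constant works. *)
definition best_const :: "(real^'n \<Rightarrow> real) \<Rightarrow> real \<Rightarrow> real \<Rightarrow> real \<Rightarrow> ennreal" where
  "best_const Q p q R = Inf {C. \<forall>f\<in>D.
     Lp_norm p (lebesgue_on (T R)) (extension_op Q f) \<le> C * Lp_norm q (lebesgue_on Omega) f}"

end

theory Submission
  imports Defs "HOL-Probability.Probability"
begin

text \<open>
  A near-extremiser \<open>f\<close> for \<open>T R\<close> may have a tiny support, so it is replaced by a sum of many
  disjointly supported copies of itself. Shrinking \<open>f\<close> by a factor \<open>\<rho>\<close> close to \<open>1\<close> makes room to
  translate it inside \<open>Omega\<close>. By parabolic scaling and Galilean invariance each copy keeps, up to a
  power of \<open>\<rho>\<close>, the \<open>L\<^sup>p\<close> norm of its extension, now over the slab \<open>T (R / \<rho>\<^sup>2)\<close>. As long as the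
  support of the current sum \<open>g\<close> has measure at most a constant \<open>\<gamma>\<close> depending on \<open>\<rho>\<close> only, averaging
  over translations yields a copy whose support meets that of \<open>g\<close> in a small fraction of its measure.
  The part of \<open>f\<close> responsible for the overlap can be deleted, because its contribution is
  controlled by \<open>best_const\<close> itself. If \<open>h\<close> is what is left of the copy, then by Clarkson's inequality
  (\<open>p \<ge> 2\<close>) one of \<open>g + h\<close> and \<open>g - h\<close> has energy at least the sum of the energies of \<open>g\<close> and \<open>h\<close>.
  Energies thus add up linearly in the number of copies while \<open>mass powr (p / q)\<close> grows at most
  linearly, as \<open>p \<le> q\<close>, so the ratio of the norms is not lost.
  Finiteness of \<open>best_const\<close> follows from Plancherel's inequality on each time slice.
\<close>

subsection \<open>Plancherel's inequality\<close>

lemma nn_integral_lborel_affine: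
  fixes f :: "'a::euclidean_space \<Rightarrow> ennreal"
  assumes [measurable]: "f \<in> borel_measurable borel" and "c \<noteq> 0"
  shows "(\<integral>\<^sup>+x. f x \<partial>lborel) = ennreal (\<bar>c\<bar> ^ DIM('a)) * (\<integral>\<^sup>+x. f (t + c *\<^sub>R x) \<partial>lborel)"
  by (subst lborel_affine[OF \<open>c \<noteq> 0\<close>, of t])
     (simp add: nn_integral_density nn_integral_distr nn_integral_cmult)

text \<open>A nonintegrable function has Bochner integral 0, so the bound can be invoked before
  integrability is established.\<close>

lemma norm_integral_le_nn_integral:
  fixes f :: "'a \<Rightarrow> 'b::{banach, second_countable_topology}"
  shows "ennreal (norm (integral\<^sup>L M f)) \<le> (\<integral>\<^sup>+x. ennreal (norm (f x)) \<partial>M)"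
  by (cases "integrable M f") (auto intro: integral_norm_bound_ennreal simp: not_integrable_integral_eq)

text \<open>The substitution \<open>x = \<sigma> * u\<close> in the characteristic function of the
  standard normal law, evaluated at \<open>z / \<sigma>\<close>. A small \<open>\<sigma>\<close>
  gives a wide Gaussian whose transform concentrates near 0.\<close>

lemma gaussian_fourier_real:
  fixes \<sigma> z :: real
  assumes "\<sigma> > 0"
  shows "integrable lborel (\<lambda>u. complex_of_real (exp (- (\<sigma> * u)\<^sup>2 / 2)) * cis (u * z))"
    and "(LINT u|lborel. complex_of_real (exp (- (\<sigma> * u)\<^sup>2 / 2)) * cis (u * z))
      = complex_of_real (2 * pi * normal_density 0 \<sigma> z)"
proof -
  have eq: "exp (- (\<sigma> * u)\<^sup>2 / 2) = sqrt (2 * pi) * std_normal_density (0 + \<sigma> * u)" for u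
    by (simp add: std_normal_density_def)
  have "integrable lborel (\<lambda>u. sqrt (2 * pi) * std_normal_density (0 + \<sigma> * u))"
    using assms by (intro integrable_mult_right lborel_integrable_real_affine) auto
  then have "integrable lborel (\<lambda>u. exp (- (\<sigma> * u)\<^sup>2 / 2))"
    by (simp only: eq)
  then show "integrable lborel (\<lambda>u. complex_of_real (exp (- (\<sigma> * u)\<^sup>2 / 2)) * cis (u * z))"
  proof (rule Bochner_Integration.integrable_bound)
    have "(\<lambda>x. cis (x * z)) \<in> borel_measurable borel"
      by (intro borel_measurable_continuous_onI continuous_intros)
    then show "(\<lambda>u. complex_of_real (exp (- (\<sigma> * u)\<^sup>2 / 2)) * cis (u * z)) \<in> borel_measurable lborel"
      by measurable
  qed (simp add: norm_mult)
  have "complex_of_real (exp (- ((z / \<sigma>)\<^sup>2) / 2)) = char std_normal_distribution (z / \<sigma>)"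
    by (simp add: char_std_normal_distribution)
  also have "\<dots> = (LINT x|lborel. std_normal_density x *\<^sub>R cis (z / \<sigma> * x))"
    unfolding char_def by (subst integral_density) (auto simp: cis_conv_exp)
  also have "\<dots> = \<sigma> *\<^sub>R (LINT u|lborel. std_normal_density (0 + \<sigma> * u) *\<^sub>R cis (z / \<sigma> * (0 + \<sigma> * u)))"
    using assms by (subst lborel_integral_real_affine[where c = \<sigma> and t = 0]) auto
  also have "\<dots> = \<sigma> *\<^sub>R (LINT u|lborel. (1 / sqrt (2 * pi)) *\<^sub>R
                    (complex_of_real (exp (- (\<sigma> * u)\<^sup>2 / 2)) * cis (u * z)))"
    using assms by (simp add: std_normal_density_def scaleR_conv_of_real mult.commute)
  finally have "(LINT u|lborel. complex_of_real (exp (- (\<sigma> * u)\<^sup>2 / 2)) * cis (u * z))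
      = complex_of_real (sqrt (2 * pi) / \<sigma> * exp (- ((z / \<sigma>)\<^sup>2) / 2))"
    using assms by (simp add: scaleR_conv_of_real field_simps)
  also have "sqrt (2 * pi) / \<sigma> * exp (- ((z / \<sigma>)\<^sup>2) / 2) = 2 * pi * normal_density 0 \<sigma> z"
    using assms by (simp add: normal_density_def real_sqrt_mult power_divide field_simps)
  finally show "(LINT u|lborel. complex_of_real (exp (- (\<sigma> * u)\<^sup>2 / 2)) * cis (u * z))
      = complex_of_real (2 * pi * normal_density 0 \<sigma> z)" .
qed

text \<open>This is \<open>exp (- \<sigma>^2 |x|^2 / 2)\<close>, written over coordinates so that
  integrals split into one-dimensional ones.\<close>

definition gauss :: "real \<Rightarrow> 'a::euclidean_space \<Rightarrow> real" where
  "gauss \<sigma> x = (\<Prod>b\<in>Basis. exp (- (\<sigma> * (x \<bullet> b))\<^sup>2 / 2))"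

text \<open>The Fourier transform of \<open>gauss \<sigma>\<close>: \<open>(2 * pi)^n\<close> times
  the density of a centred normal law with independent coordinates of standard deviation
  \<open>\<sigma>\<close>.\<close>

definition gauss_hat :: "real \<Rightarrow> 'a::euclidean_space \<Rightarrow> real" where
  "gauss_hat \<sigma> z = (\<Prod>b\<in>Basis. 2 * pi * normal_density 0 \<sigma> (z \<bullet> b))"

lemma gauss_pos: "gauss \<sigma> x > 0"
  by (simp add: gauss_def prod_pos)

lemma gauss_nonneg: "gauss \<sigma> x \<ge> 0"
  using gauss_pos less_imp_le by blast

lemma gauss_hat_nonneg: "gauss_hat \<sigma> x \<ge> 0"
  by (simp add: gauss_hat_def prod_nonneg)

lemma gauss_measurable [measurable]: "gauss \<sigma> \<in> borel_measurable borel"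
  unfolding gauss_def[abs_def] by measurable

lemma gauss_hat_measurable [measurable]: "gauss_hat \<sigma> \<in> borel_measurable borel"
  unfolding gauss_hat_def[abs_def] by measurable

lemma nn_integral_gauss_hat:
  assumes "\<sigma> > 0"
  shows "(\<integral>\<^sup>+z. ennreal (gauss_hat \<sigma> (z::'a::euclidean_space)) \<partial>lborel) = ennreal ((2 * pi) ^ DIM('a))"
proof -
  have one: "(\<integral>\<^sup>+x. ennreal (2 * pi * normal_density 0 \<sigma> x) \<partial>lborel) = ennreal (2 * pi)"
    using assms by (subst nn_integral_eq_integral) auto
  have "(\<integral>\<^sup>+z. ennreal (gauss_hat \<sigma> (z::'a)) \<partial>lborel)
      = (\<integral>\<^sup>+z. (\<Prod>b\<in>Basis. ennreal (2 * pi * normal_density 0 \<sigma> (z \<bullet> b))) \<partial>(lborel::'a measure))"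
    unfolding gauss_hat_def by (subst prod_ennreal) auto
  also have "\<dots> = (\<Prod>b\<in>(Basis::'a set). ennreal (2 * pi))"
    by (subst nn_integral_lborel_prod) (auto simp: one)
  also have "\<dots> = ennreal ((2 * pi) ^ DIM('a))"
    by (simp add: ennreal_power)
  finally show ?thesis .
qed

text \<open>\<open>lborel\<close> is the image of a product of one-dimensional Lebesgue measures,
  and both the weight and the character \<open>cis (x \<bullet> z)\<close> factor over the
  coordinates, which reduces everything to the real line.\<close>

lemma gauss_fourier:
  fixes z :: "'a::euclidean_space"
  assumes "\<sigma> > 0"
  shows "integrable lborel (\<lambda>x. complex_of_real (gauss \<sigma> x) * cis (x \<bullet> z))"
    and "(LINT x|lborel. complex_of_real (gauss \<sigma> x) * cis (x \<bullet> z)) = complex_of_real (gauss_hat \<sigma> z)"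
proof -
  interpret product_sigma_finite "\<lambda>_::'a. lborel :: real measure" ..
  let ?F = "\<lambda>x::'a. complex_of_real (gauss \<sigma> x) * cis (x \<bullet> z)"
  let ?f = "\<lambda>b u. complex_of_real (exp (- (\<sigma> * u)\<^sup>2 / 2)) * cis (u * (z \<bullet> b))"
  let ?P = "\<lambda>f::'a \<Rightarrow> real. \<Sum>b\<in>Basis. f b *\<^sub>R b"
  have cis_prod: "cis (\<Sum>b\<in>B. h b) = (\<Prod>b\<in>B. cis (h b))" if "finite B" for B and h :: "'a \<Rightarrow> real"
    using that by (induction) (auto simp: cis_mult[symmetric])
  have F: "?F (?P f) = (\<Prod>b\<in>Basis. ?f b (f b))" for f
  proof -
    have "?P f \<bullet> b = f b" if "b \<in> Basis" for b
      using that by (simp add: inner_sum_left inner_Basis if_distrib sum.delta cong: if_cong)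
    then show ?thesis
      by (subst euclidean_inner) (simp add: gauss_def cis_prod prod.distrib)
  qed
  have Fm [measurable]: "?F \<in> borel_measurable borel"
  proof -
    have "(\<lambda>x. cis (x \<bullet> z)) \<in> borel_measurable borel"
      by (intro borel_measurable_continuous_onI continuous_intros)
    then show ?thesis by measurable
  qed
  have Pm [measurable]: "?P \<in> (\<Pi>\<^sub>M b\<in>Basis. lborel) \<rightarrow>\<^sub>M borel"
    by measurable
  have i: "integrable (Pi\<^sub>M Basis (\<lambda>_. lborel)) (\<lambda>f. \<Prod>b\<in>Basis. ?f b (f b))"
    by (intro product_integrable_prod gaussian_fourier_real assms) auto
  show "integrable lborel ?F"
    by (subst lborel_eq, subst integrable_distr_eq) (use i in \<open>auto simp: F\<close>)
  have "integral\<^sup>L lborel ?F = integral\<^sup>L (Pi\<^sub>M Basis (\<lambda>_. lborel)) (\<lambda>f. \<Prod>b\<in>Basis. ?f b (f b))"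
    by (subst lborel_eq, subst integral_distr) (auto simp: F)
  also have "\<dots> = (\<Prod>b\<in>Basis. complex_of_real (2 * pi * normal_density 0 \<sigma> (z \<bullet> b)))"
    by (subst product_integral_prod[OF finite_Basis gaussian_fourier_real(1)[OF assms]])
       (simp only: gaussian_fourier_real(2)[OF assms])
  finally show "integral\<^sup>L lborel ?F = complex_of_real (gauss_hat \<sigma> z)"
    by (simp add: gauss_hat_def)
qed

text \<open>Expanding the square and integrating in \<open>x\<close> first produces the kernel \<open>gauss_hat\<close>, whose total
  mass does not depend on \<open>\<sigma>\<close>; this is what survives the limit \<open>\<sigma> \<rightarrow> 0\<close>.\<close>

lemma plancherel_gauss:
  fixes g :: "'a::euclidean_space \<Rightarrow> complex"
  assumes X: "X \<in> lmeasurable" and g [measurable]: "g \<in> borel_measurable (lebesgue_on X)"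
    and g1: "\<And>\<xi>. norm (g \<xi>) \<le> 1" and "\<sigma> > 0"
  shows "(\<integral>\<^sup>+x. ennreal (gauss \<sigma> x * (norm (LINT \<xi>|lebesgue_on X. g \<xi> * cis (x \<bullet> \<xi>)))\<^sup>2) \<partial>lborel)
       \<le> ennreal ((2 * pi) ^ DIM('a)) * (\<integral>\<^sup>+\<xi>. ennreal (norm (g \<xi>)) \<partial>lebesgue_on X)"
proof -
  let ?M = "lebesgue_on X"
  interpret M: finite_measure ?M
    using X by (rule finite_measure_lebesgue_on)
  interpret P: pair_sigma_finite "lborel::'a measure" ?M ..
  define ghat where "ghat x = (LINT \<xi>|?M. g \<xi> * cis (x \<bullet> \<xi>))" for x
  have id_m [measurable]: "(\<lambda>\<xi>. \<xi>) \<in> ?M \<rightarrow>\<^sub>M borel"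
    by (simp add: measurable_completion measurable_restrict_space1)
  have cis_m [measurable]: "cis \<in> borel_measurable borel"
    by (intro borel_measurable_continuous_onI continuous_intros)
  have cnj_m [measurable]: "cnj \<in> borel_measurable borel"
    by (intro borel_measurable_continuous_onI continuous_intros)
  have ghat_m [measurable]: "ghat \<in> borel_measurable borel"
    unfolding ghat_def[abs_def] by measurable
  have mX: "measure ?M X = measure lebesgue X"
    using X by (simp add: measure_restrict_space fmeasurableD)
  have ghat_le: "norm (ghat x) \<le> measure lebesgue X" for x
  proof -
    have "integrable ?M (\<lambda>\<xi>. g \<xi> * cis (x \<bullet> \<xi>))"
      by (rule M.integrable_const_bound[where B = 1]) (auto simp: norm_mult g1)
    then have "norm (ghat x) \<le> (LINT \<xi>|?M. 1)"
      unfolding ghat_def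
      by (rule Bochner_Integration.integral_norm_bound_integral) (auto simp: norm_mult g1)
    then show ?thesis by (simp add: mX)
  qed
  have W: "integrable lborel (gauss \<sigma> :: 'a \<Rightarrow> real)"
    using gauss_fourier(1)[OF \<open>\<sigma> > 0\<close>, of 0] by (simp add: complex_of_real_integrable_eq)
  \<comment> \<open>A majorant on the product space, constant in \<open>\<xi>\<close>; it is
    integrable because the Gaussian is and \<open>X\<close> has finite measure. It justifies both
    exchanges of integrals below.\<close>
  have W2: "integrable (lborel \<Otimes>\<^sub>M ?M) (\<lambda>(x, \<xi>). C * gauss \<sigma> (x::'a))" for C
    by (rule P.Fubini_integrable) (use W gauss_pos[of \<sigma>] in \<open>auto simp: abs_mult less_imp_le\<close>)
  have fub1: "integrable (lborel \<Otimes>\<^sub>M ?M)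
     (\<lambda>(x, \<xi>). complex_of_real (gauss \<sigma> x) * cnj (ghat x) * (g \<xi> * cis (x \<bullet> \<xi>)))"
  proof (rule Bochner_Integration.integrable_bound[OF W2[of "measure lebesgue X"]])
    show "AE z in lborel \<Otimes>\<^sub>M ?M. norm (case z of (x, \<xi>) \<Rightarrow>
       complex_of_real (gauss \<sigma> x) * cnj (ghat x) * (g \<xi> * cis (x \<bullet> \<xi>)))
       \<le> norm (case z of (x, \<xi>) \<Rightarrow> measure lebesgue X * gauss \<sigma> x)"
    proof (intro AE_I2, clarify)
      fix x :: 'a and \<xi>
      have "norm (ghat x) * norm (g \<xi>) \<le> measure lebesgue X * 1"
        by (intro mult_mono ghat_le g1) auto
      then have "gauss \<sigma> x * (norm (ghat x) * norm (g \<xi>)) \<le> gauss \<sigma> x * measure lebesgue X"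
        using gauss_pos[of \<sigma> x] by (simp add: mult_left_mono)
      then show "norm (complex_of_real (gauss \<sigma> x) * cnj (ghat x) * (g \<xi> * cis (x \<bullet> \<xi>)))
          \<le> norm (measure lebesgue X * gauss \<sigma> x)"
        using gauss_pos[of \<sigma> x] by (simp add: norm_mult abs_mult mult_ac)
    qed
  qed measurable
  have fub2: "integrable (lborel \<Otimes>\<^sub>M ?M)
     (\<lambda>(x, \<eta>). complex_of_real (gauss \<sigma> x) * cis (x \<bullet> \<xi>) * cnj (g \<eta> * cis (x \<bullet> \<eta>)))" for \<xi>
  proof (rule Bochner_Integration.integrable_bound[OF W2[of 1]])
    show "AE z in lborel \<Otimes>\<^sub>M ?M. norm (case z of (x, \<eta>) \<Rightarrow>
       complex_of_real (gauss \<sigma> x) * cis (x \<bullet> \<xi>) * cnj (g \<eta> * cis (x \<bullet> \<eta>)))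
       \<le> norm (case z of (x, \<eta>) \<Rightarrow> 1 * gauss \<sigma> x)"
      using g1 by (intro AE_I2) (auto simp: norm_mult mult_left_le)
  qed measurable
  \<comment> \<open>Integrating over \<open>x\<close> turns the product of two characters into
    \<open>gauss_hat\<close> at the difference of the frequencies.\<close>
  have inner: "(LINT x|lborel. complex_of_real (gauss \<sigma> x) * cis (x \<bullet> \<xi>) * cnj (ghat x))
      = (LINT \<eta>|?M. cnj (g \<eta>) * complex_of_real (gauss_hat \<sigma> (\<xi> - \<eta>)))" for \<xi>
  proof -
    have "(LINT x|lborel. complex_of_real (gauss \<sigma> x) * cis (x \<bullet> \<xi>) * cnj (ghat x))
      = (LINT x|lborel. LINT \<eta>|?M. complex_of_real (gauss \<sigma> x) * cis (x \<bullet> \<xi>) * cnj (g \<eta> * cis (x \<bullet> \<eta>)))"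
      unfolding ghat_def
      by (intro Bochner_Integration.integral_cong refl)
         (simp only: integral_mult_right_zero Bochner_Integration.integral_cnj)
    also have "\<dots> = (LINT \<eta>|?M. LINT x|lborel. complex_of_real (gauss \<sigma> x) * cis (x \<bullet> \<xi>) * cnj (g \<eta> * cis (x \<bullet> \<eta>)))"
      by (rule P.Fubini_integral[OF fub2, symmetric])
    also have "\<dots> = (LINT \<eta>|?M. LINT x|lborel. cnj (g \<eta>) * (complex_of_real (gauss \<sigma> x) * cis (x \<bullet> (\<xi> - \<eta>))))"
      by (intro Bochner_Integration.integral_cong refl)
         (simp add: inner_diff_right cis_cnj cis_divide[symmetric] cis_inverse[symmetric] field_simps del: cis_inverse)
    also have "\<dots> = (LINT \<eta>|?M. cnj (g \<eta>) * complex_of_real (gauss_hat \<sigma> (\<xi> - \<eta>)))"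
      by (simp only: integral_mult_right_zero gauss_fourier(2)[OF \<open>\<sigma> > 0\<close>])
    finally show ?thesis .
  qed
  have hat_le: "(\<integral>\<^sup>+\<eta>. ennreal (gauss_hat \<sigma> (\<xi> - \<eta>)) \<partial>?M) \<le> ennreal ((2 * pi) ^ DIM('a))" for \<xi>
  proof -
    have "(\<integral>\<^sup>+\<eta>. ennreal (gauss_hat \<sigma> (\<xi> - \<eta>)) \<partial>?M)
       \<le> (\<integral>\<^sup>+\<eta>. ennreal (gauss_hat \<sigma> (\<xi> - \<eta>)) \<partial>lebesgue)"
      using X by (subst nn_integral_restrict_space)
        (auto simp: fmeasurableD indicator_def intro!: nn_integral_mono)
    also have "\<dots> = (\<integral>\<^sup>+\<eta>. ennreal (gauss_hat \<sigma> (\<xi> + (-1) *\<^sub>R \<eta>)) \<partial>lborel)"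
      by (simp add: nn_integral_completion)
    also have "\<dots> = (\<integral>\<^sup>+\<eta>. ennreal (gauss_hat \<sigma> (\<eta>::'a)) \<partial>lborel)"
      using nn_integral_lborel_affine[of "\<lambda>\<eta>. ennreal (gauss_hat \<sigma> \<eta>)" "-1" \<xi>] by simp
    finally show ?thesis
      using nn_integral_gauss_hat[OF \<open>\<sigma> > 0\<close>, where 'a='a] by simp
  qed
  have "complex_of_real (LINT x|lborel. gauss \<sigma> x * (norm (ghat x))\<^sup>2)
     = (LINT x|lborel. complex_of_real (gauss \<sigma> x) * cnj (ghat x) * ghat x)"
    unfolding integral_complex_of_real[symmetric]
    by (intro Bochner_Integration.integral_cong refl)
       (simp add: complex_norm_square[symmetric] mult.commute[of "cnj _"] mult.assoc)
  also have "\<dots> = (LINT x|lborel. LINT \<xi>|?M. complex_of_real (gauss \<sigma> x) * cnj (ghat x) * (g \<xi> * cis (x \<bullet> \<xi>)))"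
    by (subst (2) ghat_def) (simp only: integral_mult_right_zero)
  also have "\<dots> = (LINT \<xi>|?M. LINT x|lborel. complex_of_real (gauss \<sigma> x) * cnj (ghat x) * (g \<xi> * cis (x \<bullet> \<xi>)))"
    by (rule P.Fubini_integral[OF fub1, symmetric])
  also have "\<dots> = (LINT \<xi>|?M. LINT x|lborel. g \<xi> * (complex_of_real (gauss \<sigma> x) * cis (x \<bullet> \<xi>) * cnj (ghat x)))"
    by (intro Bochner_Integration.integral_cong refl) (simp add: algebra_simps)
  also have "\<dots> = (LINT \<xi>|?M. g \<xi> * (LINT \<eta>|?M. cnj (g \<eta>) * complex_of_real (gauss_hat \<sigma> (\<xi> - \<eta>))))"
    by (simp only: integral_mult_right_zero inner)
  finally have key: "complex_of_real (LINT x|lborel. gauss \<sigma> x * (norm (ghat x))\<^sup>2) = \<dots>" .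
  note id_m [measurable del]
  have int: "integrable lborel (\<lambda>x. gauss \<sigma> x * (norm (ghat x))\<^sup>2)"
  proof (rule Bochner_Integration.integrable_bound[OF integrable_mult_right[OF W, of "(measure lebesgue X)\<^sup>2"]])
    show "AE x in lborel. norm (gauss \<sigma> x * (norm (ghat x))\<^sup>2) \<le> norm ((measure lebesgue X)\<^sup>2 * gauss \<sigma> x)"
      using gauss_pos[of \<sigma>] by (intro AE_I2)
        (auto simp: abs_mult less_imp_le mult.commute intro!: mult_left_mono power_mono ghat_le)
  qed measurable
  have nn: "(LINT x|lborel. gauss \<sigma> x * (norm (ghat x))\<^sup>2) \<ge> 0"
    by (intro integral_nonneg_AE AE_I2) (simp add: gauss_nonneg)
  have "(\<integral>\<^sup>+x. ennreal (gauss \<sigma> x * (norm (ghat x))\<^sup>2) \<partial>lborel)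
      = ennreal (LINT x|lborel. gauss \<sigma> x * (norm (ghat x))\<^sup>2)"
    by (intro nn_integral_eq_integral int AE_I2) (simp add: gauss_nonneg)
  also have "\<dots> = ennreal (norm (complex_of_real (LINT x|lborel. gauss \<sigma> x * (norm (ghat x))\<^sup>2)))"
    using nn by simp
  also have "\<dots> \<le> (\<integral>\<^sup>+\<xi>. norm (g \<xi> * (LINT \<eta>|?M. cnj (g \<eta>) * complex_of_real (gauss_hat \<sigma> (\<xi> - \<eta>)))) \<partial>?M)"
    unfolding key by (rule norm_integral_le_nn_integral)
  \<comment> \<open>As in Schur's test: \<open>norm (g \<eta>) \<le> 1\<close> bounds the inner
    integral by the total mass of the kernel, and only the outer factor
    \<open>norm (g \<xi>)\<close> is left.\<close>
  also have "\<dots> \<le> (\<integral>\<^sup>+\<xi>. ennreal ((2 * pi) ^ DIM('a)) * norm (g \<xi>) \<partial>?M)"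
  proof (intro nn_integral_mono)
    fix \<xi>
    have "ennreal (norm (LINT \<eta>|?M. cnj (g \<eta>) * complex_of_real (gauss_hat \<sigma> (\<xi> - \<eta>))))
        \<le> (\<integral>\<^sup>+\<eta>. norm (cnj (g \<eta>) * complex_of_real (gauss_hat \<sigma> (\<xi> - \<eta>))) \<partial>?M)"
      by (rule norm_integral_le_nn_integral)
    also have "\<dots> \<le> (\<integral>\<^sup>+\<eta>. ennreal (gauss_hat \<sigma> (\<xi> - \<eta>)) \<partial>?M)"
      using g1 by (intro nn_integral_mono ennreal_leI)
        (simp add: norm_mult gauss_hat_nonneg mult_left_le_one_le)
    also note hat_le
    finally show "ennreal (norm (g \<xi> * (LINT \<eta>|?M. cnj (g \<eta>) * complex_of_real (gauss_hat \<sigma> (\<xi> - \<eta>)))))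
       \<le> ennreal ((2 * pi) ^ DIM('a)) * norm (g \<xi>)"
      by (simp add: norm_mult ennreal_mult mult.commute mult_left_mono)
  qed
  also have "\<dots> = ennreal ((2 * pi) ^ DIM('a)) * (\<integral>\<^sup>+\<xi>. norm (g \<xi>) \<partial>?M)"
    by (rule nn_integral_cmult) measurable
  finally show ?thesis
    by (simp add: ghat_def)
qed

text \<open>The weights with \<open>\<sigma> = 1 / Suc k\<close> tend to 1 pointwise while the
  weighted bound is uniform in \<open>\<sigma>\<close>, so Fatou's lemma removes the weight. If
  \<open>g\<close> only takes the value 0 and values of modulus 1, the integral on the right is the
  squared \<open>L^2\<close> norm of \<open>g\<close>.\<close>

lemma plancherel_bound:
  fixes g :: "'a::euclidean_space \<Rightarrow> complex"
  assumes X: "X \<in> lmeasurable" and g [measurable]: "g \<in> borel_measurable (lebesgue_on X)"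
    and g1: "\<And>\<xi>. norm (g \<xi>) \<le> 1"
  shows "(\<integral>\<^sup>+x. ennreal ((norm (LINT \<xi>|lebesgue_on X. g \<xi> * cis (x \<bullet> \<xi>)))\<^sup>2) \<partial>lborel)
       \<le> ennreal ((2 * pi) ^ DIM('a)) * (\<integral>\<^sup>+\<xi>. ennreal (norm (g \<xi>)) \<partial>lebesgue_on X)"
proof -
  let ?M = "lebesgue_on X"
  interpret M: finite_measure ?M
    using X by (rule finite_measure_lebesgue_on)
  define ghat where "ghat x = (LINT \<xi>|?M. g \<xi> * cis (x \<bullet> \<xi>))" for x
  have ghat_m [measurable]: "ghat \<in> borel_measurable borel"
  proof -
    have [measurable]: "(\<lambda>\<xi>. \<xi>) \<in> ?M \<rightarrow>\<^sub>M borel" "cis \<in> borel_measurable borel"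
      by (simp_all add: measurable_completion measurable_restrict_space1
          borel_measurable_continuous_onI continuous_intros)
    show ?thesis
      unfolding ghat_def[abs_def] by measurable
  qed
  let ?u = "\<lambda>x. (norm (ghat x))\<^sup>2"
  let ?w = "\<lambda>k x. gauss (1 / real (Suc k)) (x::'a)"
  have "(\<lambda>k. ?w k x) \<longlonglongrightarrow> 1" for x
  proof -
    have "(\<lambda>k. ?w k x) \<longlonglongrightarrow> (\<Prod>b\<in>(Basis::'a set). exp (- (0 * (x \<bullet> b))\<^sup>2 / 2))"
      unfolding gauss_def by (intro tendsto_intros lim_1_over_n[THEN LIMSEQ_Suc]) auto
    then show ?thesis by simp
  qed
  then have lim: "(\<lambda>k. ennreal (?w k x * ?u x)) \<longlonglongrightarrow> ennreal (1 * ?u x)" for x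
    by (intro tendsto_intros)
  have "(\<integral>\<^sup>+x. ennreal (?u x) \<partial>lborel) = (\<integral>\<^sup>+x. liminf (\<lambda>k. ennreal (?w k x * ?u x)) \<partial>lborel)"
    using lim_imp_Liminf[OF sequentially_bot lim] by simp
  also have "\<dots> \<le> liminf (\<lambda>k. \<integral>\<^sup>+x. ennreal (?w k x * ?u x) \<partial>lborel)"
    by (rule nn_integral_liminf) measurable
  also have "\<dots> \<le> ennreal ((2 * pi) ^ DIM('a)) * (\<integral>\<^sup>+\<xi>. ennreal (norm (g \<xi>)) \<partial>?M)"
    using plancherel_gauss[OF X g g1] by (intro Liminf_le) (auto simp: ghat_def intro!: always_eventually)
  finally show ?thesis by (simp add: ghat_def)
qed

subsection \<open>Extensions of functions in the class D\<close>

definition mass :: "(real^'n \<Rightarrow> complex) \<Rightarrow> real" where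
  "mass f = measure lebesgue {\<xi>\<in>Omega. f \<xi> \<noteq> 0}"

text \<open>The \<open>p\<close>-th power of the norm over \<open>T R\<close>. Roots are postponed
  because it is this power that, for a suitable sign, is superadditive by Clarkson's
  inequality.\<close>

definition energy :: "(real^'n \<Rightarrow> real) \<Rightarrow> real \<Rightarrow> real \<Rightarrow> (real^'n \<Rightarrow> complex) \<Rightarrow> ennreal" where
  "energy Q p R f = (\<integral>\<^sup>+ z. ennreal (norm (extension_op Q f z) powr p) \<partial>lebesgue_on (T R))"

lemma Omega_lmeasurable: "(Omega :: (real^'n) set) \<in> lmeasurable"
  by (simp add: Omega_def)

lemma Omega_sets [simp]: "Omega \<in> sets lebesgue"
  by (rule fmeasurableD[OF Omega_lmeasurable])

lemma measure_Omega: "measure lebesgue (Omega :: (real^'n) set) = 1"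
  by (simp add: Omega_def content_cbox_if_cart interval_ne_empty_cart)

lemma finite_measure_Omega: "finite_measure (lebesgue_on (Omega :: (real^'n) set))"
  by (rule finite_measure_lebesgue_on[OF Omega_lmeasurable])

lemma D_measurable: "f \<in> D \<Longrightarrow> f \<in> borel_measurable (lebesgue_on Omega)"
  and D_norm_le: "f \<in> D \<Longrightarrow> \<xi> \<in> Omega \<Longrightarrow> norm (f \<xi>) \<le> 1"
  and D_norm_eq: "f \<in> D \<Longrightarrow> \<xi> \<in> Omega \<Longrightarrow> norm (f \<xi>) = (if f \<xi> = 0 then 0 else 1)"
  by (auto simp: D_def)

lemma D_support_lmeasurable:
  fixes f :: "real^'n \<Rightarrow> complex"
  assumes "f \<in> D"
  shows "{\<xi>\<in>Omega. f \<xi> \<noteq> 0} \<in> lmeasurable"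
proof (rule fmeasurableI2[OF Omega_lmeasurable])
  have "{\<xi> \<in> space (lebesgue_on Omega). f \<xi> \<noteq> 0} \<in> sets (lebesgue_on Omega)"
    using D_measurable[OF assms] by measurable
  then show "{\<xi>\<in>Omega. f \<xi> \<noteq> 0} \<in> sets lebesgue"
    using sets_restrict_space_iff[of Omega lebesgue] fmeasurableD[OF Omega_lmeasurable] by auto
qed auto

lemma mass_nonneg: "mass f \<ge> 0"
  by (simp add: mass_def)

lemma mass_le_1: "(f :: real^'n \<Rightarrow> complex) \<in> D \<Longrightarrow> mass f \<le> 1"
  unfolding mass_def measure_Omega[where 'n='n, symmetric]
  by (intro measure_mono_fmeasurable fmeasurableD D_support_lmeasurable Omega_lmeasurable) auto

text \<open>On \<open>Omega\<close> the modulus of \<open>f\<close> is 0 or 1, so each positive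
  power of it is the indicator of the support. All surface norms of \<open>f\<close> thus become
  powers of the single number \<open>mass f\<close>.\<close>

lemma nn_integral_norm_D:
  assumes "f \<in> D" "r > 0"
  shows "(\<integral>\<^sup>+\<xi>. ennreal (norm (f \<xi>) powr r) \<partial>lebesgue_on Omega) = ennreal (mass f)"
proof -
  have "(\<integral>\<^sup>+\<xi>. ennreal (norm (f \<xi>) powr r) \<partial>lebesgue_on Omega)
      = (\<integral>\<^sup>+\<xi>. indicator {\<xi>\<in>Omega. f \<xi> \<noteq> 0} \<xi> \<partial>lebesgue)"
    using assms Omega_lmeasurable
    by (subst nn_integral_restrict_space)
       (auto simp: fmeasurableD indicator_def D_norm_eq intro!: nn_integral_cong)
  also have "\<dots> = ennreal (mass f)"
    using D_support_lmeasurable[OF assms(1)]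
    by (simp add: mass_def emeasure_eq_measure2 fmeasurableD)
  finally show ?thesis .
qed

lemma Lp_norm_D:
  assumes "f \<in> D" "q > 0"
  shows "Lp_norm q (lebesgue_on Omega) f = ennreal (mass f powr (1 / q))"
  by (simp add: Lp_norm_def Let_def nn_integral_norm_D[OF assms] mass_nonneg)

section \<open>Regularity and size of extensions\<close>

lemma quadratic_form_continuous:
  assumes "quadratic_form (Q :: real^'n \<Rightarrow> real)"
  shows "continuous_on UNIV Q"
proof -
  obtain B where B: "bilinear B" "Q = (\<lambda>x. B x x)"
    using assms by (auto simp: quadratic_form_def)
  then interpret bounded_bilinear B
    by (simp add: bilinear_conv_bounded_bilinear)
  show ?thesis
    unfolding B(2) by (intro continuous_on continuous_on_id)
qed

lemma extension_op_cis:
  "extension_op Q f (x, t) = (LINT \<xi>|lebesgue_on Omega. f \<xi> * cis (x \<bullet> \<xi> + t * Q \<xi>))"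
  by (simp add: extension_op_def cis_conv_exp)

lemma phase_measurable:
  assumes "Q \<in> borel_measurable borel"
  shows "(\<lambda>\<xi>. cis (x \<bullet> \<xi> + t * Q \<xi>)) \<in> borel_measurable (lebesgue_on Omega)"
proof -
  have [measurable]: "cis \<in> borel_measurable borel"
    by (intro borel_measurable_continuous_onI continuous_intros)
  have "(\<lambda>\<xi>. cis (x \<bullet> \<xi> + t * Q \<xi>)) \<in> borel_measurable borel"
    using assms by measurable
  then show ?thesis
    by (intro measurable_restrict_space1 measurable_completion) simp
qed

lemma extension_op_integrable:
  assumes "Q \<in> borel_measurable borel" "f \<in> D"
  shows "integrable (lebesgue_on Omega) (\<lambda>\<xi>. f \<xi> * cis (x \<bullet> \<xi> + t * Q \<xi>))"
proof -
  interpret finite_measure "lebesgue_on (Omega :: (real^'a) set)"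
    by (rule finite_measure_Omega)
  show ?thesis
  proof (rule integrable_const_bound[where B = 1])
    show "AE \<xi> in lebesgue_on Omega. norm (f \<xi> * cis (x \<bullet> \<xi> + t * Q \<xi>)) \<le> 1"
      using assms(2) by (intro AE_I2) (auto simp: norm_mult D_norm_le)
  qed (intro borel_measurable_times D_measurable phase_measurable assms)
qed

lemma extension_op_norm_le:
  assumes "f \<in> D"
  shows "norm (extension_op Q f z) \<le> mass f"
proof -
  obtain x t where z: "z = (x, t)" by force
  have "ennreal (norm (extension_op Q f z))
      \<le> (\<integral>\<^sup>+\<xi>. ennreal (norm (f \<xi> * cis (x \<bullet> \<xi> + t * Q \<xi>))) \<partial>lebesgue_on Omega)"
    unfolding z extension_op_cis by (rule norm_integral_le_nn_integral)
  also have "\<dots> = ennreal (mass f)"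
    using nn_integral_norm_D[OF assms, of 1] by (simp add: norm_mult)
  finally show ?thesis by (simp add: mass_nonneg)
qed

lemma extension_op_measurable:
  assumes [measurable]: "Q \<in> borel_measurable borel" "f \<in> borel_measurable (lebesgue_on Omega)"
  shows "extension_op Q f \<in> borel_measurable borel"
proof -
  let ?M = "lebesgue_on (Omega :: (real^'a) set)"
  interpret finite_measure ?M
    by (rule finite_measure_Omega)
  have [measurable]: "(\<lambda>\<xi>. \<xi>) \<in> ?M \<rightarrow>\<^sub>M borel" "cis \<in> borel_measurable borel"
    by (simp_all add: measurable_completion measurable_restrict_space1
        borel_measurable_continuous_onI continuous_intros)
  have "(\<lambda>z. LINT \<xi>|?M. f \<xi> * cis (fst z \<bullet> \<xi> + snd z * Q \<xi>)) \<in> borel_measurable (borel \<Otimes>\<^sub>M borel)"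
    by measurable
  moreover have "extension_op Q f = (\<lambda>z. LINT \<xi>|?M. f \<xi> * cis (fst z \<bullet> \<xi> + snd z * Q \<xi>))"
    by (auto simp: extension_op_cis)
  ultimately show ?thesis
    by (simp add: borel_prod)
qed

text \<open>Tonelli with time outermost, so that Plancherel's inequality and the Galilean shifts,
  which depend on \<open>t\<close>, can be applied on each time slice.\<close>

lemma energy_iterated:
  assumes "Q \<in> borel_measurable borel" "f \<in> borel_measurable (lebesgue_on Omega)"
  shows "energy Q p R f = (\<integral>\<^sup>+t. indicator {-R..R} t *
           (\<integral>\<^sup>+x. ennreal (norm (extension_op Q f (x, t)) powr p) \<partial>lborel) \<partial>lborel)"
proof -
  note [measurable] = extension_op_measurable[OF assms]
  have TR [measurable]: "T R \<in> sets borel"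
    unfolding T_def by (intro borel_Times) auto
  have "energy Q p R f = (\<integral>\<^sup>+z. ennreal (norm (extension_op Q f z) powr p) * indicator (T R) z \<partial>lborel)"
    unfolding energy_def using TR
    by (subst nn_integral_restrict_space) (auto simp: nn_integral_completion)
  also have "\<dots> = (\<integral>\<^sup>+z. ennreal (norm (extension_op Q f z) powr p) * indicator (T R) z \<partial>(lborel \<Otimes>\<^sub>M lborel))"
    by (simp add: lborel_prod)
  also have "\<dots> = (\<integral>\<^sup>+t. \<integral>\<^sup>+x. ennreal (norm (extension_op Q f (x, t)) powr p) * indicator (T R) (x, t) \<partial>lborel \<partial>lborel)"
    using TR by (intro lborel_pair.nn_integral_snd[symmetric]) (simp add: lborel_prod)
  also have "\<dots> = (\<integral>\<^sup>+t. \<integral>\<^sup>+x. indicator {-R..R} t * ennreal (norm (extension_op Q f (x, t)) powr p) \<partial>lborel \<partial>lborel)"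
    by (intro nn_integral_cong) (auto simp: T_def indicator_def)
  also have "\<dots> = (\<integral>\<^sup>+t. indicator {-R..R} t *
           (\<integral>\<^sup>+x. ennreal (norm (extension_op Q f (x, t)) powr p) \<partial>lborel) \<partial>lborel)"
    by (intro nn_integral_cong nn_integral_cmult) measurable
  finally show ?thesis .
qed

text \<open>On a time slice the extension is the Fourier transform of \<open>f\<close> times a
  unimodular factor. Its modulus is at most 1, so \<open>p \<ge> 2\<close> lets the exponent be
  lowered to 2, and Plancherel bounds the slice uniformly in \<open>t\<close>; the time interval
  contributes its length \<open>2 * R\<close>.\<close>

lemma energy_le_mass:
  fixes Q :: "real^'n \<Rightarrow> real"
  assumes Q: "Q \<in> borel_measurable borel" and f: "f \<in> D" and p: "p \<ge> 2" and R: "R \<ge> 0"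
  shows "energy Q p R f \<le> ennreal (2 * R * (2 * pi) ^ CARD('n) * mass f)"
proof -
  have slice: "(\<integral>\<^sup>+x. ennreal (norm (extension_op Q f (x, t)) powr p) \<partial>lborel)
      \<le> ennreal ((2 * pi) ^ CARD('n) * mass f)" for t
  proof -
    \<comment> \<open>\<open>plancherel_bound\<close> asks for modulus at most 1 everywhere, whereas
      membership in \<open>D\<close> controls \<open>f\<close> on \<open>Omega\<close> only; hence
      the cut-off.\<close>
    define g where "g \<xi> = (if \<xi> \<in> Omega then f \<xi> * cis (t * Q \<xi>) else 0)" for \<xi>
    have g: "g \<in> borel_measurable (lebesgue_on Omega)"
    proof -
      have "(\<lambda>\<xi>. f \<xi> * cis (0 \<bullet> \<xi> + t * Q \<xi>)) \<in> borel_measurable (lebesgue_on Omega)"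
        by (intro borel_measurable_times D_measurable phase_measurable Q f)
      then show ?thesis
        by (subst measurable_cong[where g = "\<lambda>\<xi>. f \<xi> * cis (0 \<bullet> \<xi> + t * Q \<xi>)"]) (auto simp: g_def)
    qed
    have g1: "norm (g \<xi>) \<le> 1" for \<xi>
      using f by (simp add: g_def norm_mult D_norm_le)
    have E: "extension_op Q f (x, t) = (LINT \<xi>|lebesgue_on Omega. g \<xi> * cis (x \<bullet> \<xi>))" for x
      unfolding extension_op_cis
      by (intro Bochner_Integration.integral_cong refl) (auto simp: g_def cis_mult[symmetric])
    have "(\<integral>\<^sup>+x. ennreal (norm (extension_op Q f (x, t)) powr p) \<partial>lborel)
        \<le> (\<integral>\<^sup>+x. ennreal ((norm (extension_op Q f (x, t)))\<^sup>2) \<partial>lborel)"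
    proof (intro nn_integral_mono ennreal_leI)
      fix x
      have "norm (extension_op Q f (x, t)) \<le> 1"
        using extension_op_norm_le[OF f] mass_le_1[OF f] by (rule order_trans)
      then have "norm (extension_op Q f (x, t)) powr p \<le> norm (extension_op Q f (x, t)) powr 2"
        using p by (intro powr_mono') auto
      then show "norm (extension_op Q f (x, t)) powr p \<le> (norm (extension_op Q f (x, t)))\<^sup>2"
        by (simp add: powr_numeral)
    qed
    also have "\<dots> \<le> ennreal ((2 * pi) ^ DIM(real^'n)) * (\<integral>\<^sup>+\<xi>. ennreal (norm (g \<xi>)) \<partial>lebesgue_on Omega)"
      unfolding E by (rule plancherel_bound[OF Omega_lmeasurable g g1])
    also have "(\<integral>\<^sup>+\<xi>. ennreal (norm (g \<xi>)) \<partial>lebesgue_on Omega) = (\<integral>\<^sup>+\<xi>. ennreal (norm (f \<xi>) powr 1) \<partial>lebesgue_on Omega)"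
      by (intro nn_integral_cong) (auto simp: g_def norm_mult)
    also have "\<dots> = ennreal (mass f)"
      by (rule nn_integral_norm_D[OF f]) simp
    finally show ?thesis
      by (simp add: ennreal_mult mass_nonneg)
  qed
  have "energy Q p R f \<le> (\<integral>\<^sup>+t. indicator {-R..R} t * ennreal ((2 * pi) ^ CARD('n) * mass f) \<partial>lborel)"
    unfolding energy_iterated[OF Q D_measurable[OF f]]
    by (intro nn_integral_mono mult_left_mono slice) auto
  also have "\<dots> = ennreal (2 * R) * ennreal ((2 * pi) ^ CARD('n) * mass f)"
    using R by (simp add: nn_integral_multc)
  finally show ?thesis
    using R by (simp add: mass_nonneg mult.assoc flip: ennreal_mult)
qed

subsection \<open>Shrunken translates\<close>

lemma borel_hull:
  assumes S: "(S::'a::euclidean_space set) \<in> lmeasurable"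
  obtains S' where "S' \<in> sets borel" "S \<subseteq> S'" "emeasure lborel S' = ennreal (measure lebesgue S)"
proof (rule completion_upper[OF fmeasurableD[OF S]])
  fix S' assume "S' \<in> sets lborel" "S \<subseteq> S'" "emeasure lebesgue S = emeasure lborel S'"
  then show ?thesis
    using that[of S'] emeasure_eq_measure2[OF S] by (simp only: sets_lborel)
qed

text \<open>By Tonelli the measure of the overlap, integrated over all translations, is the product
  of the two measures. Hence some translation in the box has overlap at most this total divided by
  the measure of the box.\<close>

lemma exists_small_overlap:
  fixes S F :: "'a::euclidean_space set"
  assumes S: "S \<in> lmeasurable" and F: "F \<in> lmeasurable" and K: "measure lebesgue (cbox a b) > 0"
  shows "\<exists>v\<in>cbox a b. measure lebesgue ((+) v ` S \<inter> F) * measure lebesgue (cbox a b)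
           \<le> measure lebesgue S * measure lebesgue F"
proof (rule ccontr)
  assume contra: "\<not> ?thesis"
  \<comment> \<open>Borel supersets of the same measure make the overlap integrand jointly Borel in
    the translation and the point. Enlarging the sets can only enlarge the overlaps, and their
    product of measures is unchanged.\<close>
  obtain S' where S' [measurable]: "S' \<in> sets borel" and SS': "S \<subseteq> S'"
    and eS: "emeasure lborel S' = ennreal (measure lebesgue S)"
    by (rule borel_hull[OF S])
  obtain F' where F' [measurable]: "F' \<in> sets borel" and FF': "F \<subseteq> F'"
    and eF: "emeasure lborel F' = ennreal (measure lebesgue F)"
    by (rule borel_hull[OF F])
  define u where "u v = (\<integral>\<^sup>+y. indicator F' y * indicator S' (y - v) \<partial>lborel :: ennreal)" for v
  have joint [measurable]: "(\<lambda>(v, y). indicator F' y * indicator S' (y - v) :: ennreal)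
      \<in> borel_measurable (borel \<Otimes>\<^sub>M borel)"
    by measurable
  have joint' [measurable]: "(\<lambda>(v, y). indicator F' y * indicator S' (y - v) :: ennreal)
      \<in> borel_measurable (lborel \<Otimes>\<^sub>M lborel)"
    using joint measurable_cong_sets[OF sets_pair_measure_cong[OF sets_lborel sets_lborel] refl] by blast
  have u_m [measurable]: "u \<in> borel_measurable borel"
    unfolding u_def[abs_def] by measurable
  have "(\<integral>\<^sup>+v. u v \<partial>lborel) = (\<integral>\<^sup>+y. \<integral>\<^sup>+v. indicator F' y * indicator S' (y - v) \<partial>lborel \<partial>lborel)"
    unfolding u_def by (rule lborel_pair.Fubini'[OF joint', symmetric])
  also have "\<dots> = (\<integral>\<^sup>+y. indicator F' y * emeasure lborel S' \<partial>lborel)"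
  proof (rule nn_integral_cong)
    fix y :: 'a
    have "(\<integral>\<^sup>+v. indicator S' v \<partial>lborel) = (\<integral>\<^sup>+v. (indicator S' (y - v) :: ennreal) \<partial>lborel)"
      using nn_integral_lborel_affine[of "\<lambda>v::'a. indicator S' v" "-1" y] by simp
    then show "(\<integral>\<^sup>+v. indicator F' y * indicator S' (y - v) \<partial>lborel) = indicator F' y * emeasure lborel S'"
      by (subst nn_integral_cmult) (auto simp: nn_integral_indicator)
  qed
  also have "\<dots> = emeasure lborel F' * emeasure lborel S'"
    by (subst nn_integral_multc) auto
  also have "\<dots> = ennreal (measure lebesgue S * measure lebesgue F)"
    by (simp add: eS eF ennreal_mult mult.commute)
  finally have total: "(\<integral>\<^sup>+v. u v \<partial>lborel) = ennreal (measure lebesgue S * measure lebesgue F)" .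
  \<comment> \<open>The value that the overlap would exceed throughout the box if the claim failed;
    integrated over the box, \<open>c\<close> gives exactly the total computed above.\<close>
  define c where "c = measure lebesgue S * measure lebesgue F / measure lebesgue (cbox a b)"
  have u_ge: "u v > ennreal c" if "v \<in> cbox a b" for v
  proof -
    have m: "(+) v ` S \<inter> F \<in> lmeasurable"
      by (intro fmeasurable.Int measurable_translation S F)
    have "c < measure lebesgue ((+) v ` S \<inter> F)"
      using contra that K by (auto simp: c_def field_simps)
    then have "ennreal c < emeasure lebesgue ((+) v ` S \<inter> F)"
      using m K by (simp add: emeasure_eq_measure2 c_def ennreal_less_iff)
    also have "\<dots> = (\<integral>\<^sup>+y. indicator ((+) v ` S \<inter> F) y \<partial>lebesgue)"
      using m by (simp add: fmeasurableD)
    also have "\<dots> \<le> (\<integral>\<^sup>+y. indicator F' y * indicator S' (y - v) \<partial>lebesgue)"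
      using SS' FF' by (intro nn_integral_mono) (auto simp: indicator_def)
    also have "\<dots> = u v"
      by (simp add: u_def nn_integral_completion)
    finally show ?thesis .
  qed
  have eK: "emeasure lborel (cbox a b) = ennreal (measure lebesgue (cbox a b))"
    using emeasure_eq_measure2[OF lmeasurable_cbox, of a b] by simp
  have "(\<integral>\<^sup>+v. ennreal c * indicator (cbox a b) v \<partial>lborel) < (\<integral>\<^sup>+v. u v * indicator (cbox a b) v \<partial>lborel)"
  proof (rule nn_integral_less)
    \<comment> \<open>The pointwise strict inequality holds on a box of positive measure, so it
      survives integration.\<close>
    show "\<not> (AE v in lborel. u v * indicator (cbox a b) v \<le> ennreal c * indicator (cbox a b) v)"
    proof
      assume "AE v in lborel. u v * indicator (cbox a b) v \<le> ennreal c * indicator (cbox a b) v"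
      then have "AE v in lborel. v \<notin> cbox a b"
      proof (eventually_elim)
        case (elim v)
        show ?case
        proof
          assume "v \<in> cbox a b"
          then show False using elim u_ge[of v] by auto
        qed
      qed
      then have "emeasure lborel (cbox a b) = 0"
        by (subst (asm) AE_iff_measurable[OF _ refl]) auto
      then show False using K eK by simp
    qed
    show "(\<integral>\<^sup>+v. ennreal c * indicator (cbox a b) v \<partial>lborel) \<noteq> \<infinity>"
      by (simp add: nn_integral_cmult eK ennreal_mult_eq_top_iff)
    show "AE v in lborel. ennreal c * indicator (cbox a b) v \<le> u v * indicator (cbox a b) v"
      using u_ge by (intro AE_I2) (simp add: indicator_def less_imp_le)
  qed measurable
  also have "\<dots> \<le> (\<integral>\<^sup>+v. u v \<partial>lborel)"
    by (intro nn_integral_mono) (auto simp: indicator_def)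
  finally have "ennreal c * ennreal (measure lebesgue (cbox a b)) < ennreal (measure lebesgue S * measure lebesgue F)"
    unfolding total by (simp add: nn_integral_cmult eK)
  then show False
    using K by (simp add: c_def ennreal_mult[symmetric])
qed

section \<open>Affine changes of variables and copies\<close>

lemma lebesgue_affine_scaleR:
  fixes t :: "'a::euclidean_space"
  assumes "c \<noteq> 0"
  shows "lebesgue = density (distr lebesgue lebesgue (\<lambda>x. t + c *\<^sub>R x)) (\<lambda>_. ennreal (\<bar>c\<bar> ^ DIM('a)))"
    and "(\<lambda>x. t + c *\<^sub>R x) \<in> lebesgue \<rightarrow>\<^sub>M lebesgue"
  using lebesgue_affine_euclidean[of "\<lambda>_. c" t] lebesgue_affine_measurable[of "\<lambda>_. c" t] assms
  unfolding scaleR_scaleR[symmetric] scaleR_sum_right[symmetric] euclidean_representation by simp_all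

lemma integral_lebesgue_affine:
  fixes f :: "'a::euclidean_space \<Rightarrow> 'b::{banach, second_countable_topology}"
  assumes "f \<in> borel_measurable lebesgue" "c \<noteq> 0"
  shows "integral\<^sup>L lebesgue f = \<bar>c\<bar> ^ DIM('a) *\<^sub>R (LINT x|lebesgue. f (t + c *\<^sub>R x))"
proof -
  note [measurable] = assms(1) lebesgue_affine_scaleR(2)[OF assms(2), of t]
  show ?thesis
    by (subst lebesgue_affine_scaleR(1)[OF assms(2), of t])
       (simp add: integral_density integral_distr)
qed

text \<open>No factor compensates for the scaling, so the values stay 0 or unimodular and the class
  \<open>D\<close> is preserved. The test against \<open>Omega\<close> discards the arbitrary values
  of \<open>f\<close> outside it.\<close>

definition copy :: "real^'n \<Rightarrow> real \<Rightarrow> (real^'n \<Rightarrow> complex) \<Rightarrow> real^'n \<Rightarrow> complex" where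
  "copy v c f \<eta> = (let \<xi> = (\<eta> - v) /\<^sub>R c in if \<xi> \<in> Omega then f \<xi> else 0)"

lemma copy_affine: "c \<noteq> 0 \<Longrightarrow> copy v c f (v + c *\<^sub>R \<xi>) = (if \<xi> \<in> Omega then f \<xi> else 0)"
  by (simp add: copy_def)

lemma affine_in_Omega:
  assumes "0 < c" "c \<le> 1" "v \<in> cbox 0 ((1 - c) *\<^sub>R 1)" "\<xi> \<in> Omega"
  shows "v + c *\<^sub>R \<xi> \<in> Omega"
proof -
  have "0 \<le> v $ i + c * \<xi> $ i \<and> v $ i + c * \<xi> $ i \<le> 1" for i
  proof -
    have "0 \<le> v $ i" "v $ i \<le> 1 - c" "0 \<le> \<xi> $ i" "\<xi> $ i \<le> 1"
      using assms by (auto simp: Omega_def mem_box_cart)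
    moreover from this have "c * \<xi> $ i \<le> c * 1" "0 \<le> c * \<xi> $ i"
      using assms by (intro mult_left_mono mult_nonneg_nonneg; simp)+
    ultimately show ?thesis by linarith
  qed
  then show ?thesis by (simp add: Omega_def mem_box_cart)
qed

lemma copy_support:
  assumes "0 < c" "c \<le> 1" "v \<in> cbox 0 ((1 - c) *\<^sub>R 1)"
  shows "{\<eta>\<in>Omega. copy v c f \<eta> \<noteq> 0} = (\<lambda>\<xi>. v + c *\<^sub>R \<xi>) ` {\<xi>\<in>Omega. f \<xi> \<noteq> 0}"
proof (intro equalityI subsetI)
  fix \<eta> assume \<eta>: "\<eta> \<in> {\<eta>\<in>Omega. copy v c f \<eta> \<noteq> 0}"
  have "\<eta> = v + c *\<^sub>R ((\<eta> - v) /\<^sub>R c)"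
    using assms by simp
  moreover have "(\<eta> - v) /\<^sub>R c \<in> {\<xi>\<in>Omega. f \<xi> \<noteq> 0}"
    using \<eta> by (auto simp: copy_def Let_def split: if_splits)
  ultimately show "\<eta> \<in> (\<lambda>\<xi>. v + c *\<^sub>R \<xi>) ` {\<xi>\<in>Omega. f \<xi> \<noteq> 0}"
    by (rule image_eqI)
qed (use assms in \<open>auto simp: copy_affine affine_in_Omega\<close>)

lemma copy_mass:
  assumes "0 < c" "c \<le> 1" "v \<in> cbox 0 ((1 - c) *\<^sub>R 1)"
  shows "mass (copy v c f) = c ^ CARD('n) * mass (f :: real^'n \<Rightarrow> complex)"
proof -
  have "mass (copy v c f) = measure lebesgue ((\<lambda>\<xi>. c *\<^sub>R \<xi> + v) ` {\<xi>\<in>Omega. f \<xi> \<noteq> 0})"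
    unfolding mass_def copy_support[OF assms] by (simp add: add.commute)
  then show ?thesis
    using assms by (simp add: measure_lebesgue_affine mass_def)
qed

lemma copy_measurable:
  assumes "c \<noteq> 0" "f \<in> borel_measurable (lebesgue_on Omega)"
  shows "copy v c f \<in> borel_measurable lebesgue"
proof -
  have "(\<lambda>\<xi>. if \<xi> \<in> Omega then f \<xi> else 0) \<in> borel_measurable lebesgue"
  proof -
    have "(\<lambda>\<xi>. indicator Omega \<xi> *\<^sub>R f \<xi>) \<in> borel_measurable lebesgue"
      using assms(2) by (subst (asm) borel_measurable_restrict_space_iff) auto
    also have "(\<lambda>\<xi>. indicator Omega \<xi> *\<^sub>R f \<xi>) = (\<lambda>\<xi>. if \<xi> \<in> Omega then f \<xi> else 0)"
      by (auto simp: indicator_def)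
    finally show ?thesis .
  qed
  moreover have "(\<lambda>\<eta>. - v /\<^sub>R c + (1 / c) *\<^sub>R \<eta>) \<in> lebesgue \<rightarrow>\<^sub>M lebesgue"
    using assms(1) by (intro lebesgue_affine_scaleR) simp
  ultimately have "(\<lambda>\<eta>. if - v /\<^sub>R c + (1 / c) *\<^sub>R \<eta> \<in> Omega then f (- v /\<^sub>R c + (1 / c) *\<^sub>R \<eta>) else 0)
      \<in> borel_measurable lebesgue"
    by (rule measurable_compose[rotated])
  moreover have "- v /\<^sub>R c + (1 / c) *\<^sub>R \<eta> = (\<eta> - v) /\<^sub>R c" for \<eta>
    by (simp add: algebra_simps inverse_eq_divide)
  ultimately show ?thesis
    unfolding copy_def[abs_def] Let_def by (simp only:)
qed

lemma copy_in_D: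
  assumes "c \<noteq> 0" "f \<in> D"
  shows "copy v c f \<in> D"
  using copy_measurable[OF assms(1) D_measurable[OF assms(2)], of v] assms(2)
  by (auto simp: D_def copy_def Let_def intro: measurable_restrict_space1)

text \<open>Expanding the bilinear form leaves the mixed terms \<open>B v \<xi> + B \<xi> v\<close>,
  a linear functional of \<open>\<xi>\<close>, which is represented as an inner product by means of
  its adjoint.\<close>

lemma quadratic_form_affine:
  assumes "quadratic_form (Q :: real^'n \<Rightarrow> real)"
  obtains w where "\<And>\<xi>. Q (v + c *\<^sub>R \<xi>) = Q v + c * (w \<bullet> \<xi>) + c\<^sup>2 * Q \<xi>"
proof -
  obtain B where B: "bilinear B" "Q = (\<lambda>x. B x x)"
    using assms by (auto simp: quadratic_form_def)
  define l where "l \<xi> = B v \<xi> + B \<xi> v" for \<xi>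
  have "linear l"
    using B(1) unfolding l_def bilinear_def by (intro linear_compose_add) auto
  then have l: "l \<xi> = adjoint l 1 \<bullet> \<xi>" for \<xi>
    using adjoint_works[of l \<xi> 1] by (simp add: inner_commute)
  have "Q (v + c *\<^sub>R \<xi>) = Q v + c * l \<xi> + c\<^sup>2 * Q \<xi>" for \<xi>
    using B(1) unfolding B(2) l_def
    by (simp add: bilinear_ladd bilinear_radd bilinear_lmul bilinear_rmul algebra_simps power2_eq_square)
  then show ?thesis
    using that[of "adjoint l 1"] l by simp
qed

text \<open>Substituting \<open>v + c *\<^sub>R \<xi>\<close> splits the phase into a constant,
  which the norm removes, and the phase of \<open>f\<close> at a rescaled point. The linear term
  \<open>w\<close> of \<open>Q\<close> becomes the Galilean shift in space, proportional to
  \<open>t\<close>, and the quadratic term rescales time by \<open>c\<^sup>2\<close>.\<close>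

lemma extension_op_copy:
  fixes Q :: "real^'n \<Rightarrow> real"
  assumes Q: "quadratic_form Q" and f: "f \<in> D" and v: "0 < c" "c \<le> 1" "v \<in> cbox 0 ((1 - c) *\<^sub>R 1)"
  shows "\<exists>w. \<forall>x t. norm (extension_op Q (copy v c f) (x, t))
      = c ^ CARD('n) * norm (extension_op Q f ((c * t) *\<^sub>R w + c *\<^sub>R x, c\<^sup>2 * t))"
proof -
  obtain w where w: "\<And>\<xi>. Q (v + c *\<^sub>R \<xi>) = Q v + c * (w \<bullet> \<xi>) + c\<^sup>2 * Q \<xi>"
    using quadratic_form_affine[OF Q] by blast
  have Qm: "Q \<in> borel_measurable borel"
    using quadratic_form_continuous[OF Q] by (rule borel_measurable_continuous_onI)
  have Om: "Omega \<inter> space lebesgue \<in> sets lebesgue"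
    using fmeasurableD[OF Omega_lmeasurable] by auto
  have "norm (extension_op Q (copy v c f) (x, t))
      = c ^ CARD('n) * norm (extension_op Q f ((c * t) *\<^sub>R w + c *\<^sub>R x, c\<^sup>2 * t))" for x t
  proof -
    let ?F = "\<lambda>\<eta>. indicator Omega \<eta> *\<^sub>R (copy v c f \<eta> * cis (x \<bullet> \<eta> + t * Q \<eta>))"
    have Fm: "?F \<in> borel_measurable lebesgue"
      using borel_measurable_integrable[OF extension_op_integrable[OF Qm copy_in_D[OF _ f]], of c v x t] v
      by (simp add: borel_measurable_restrict_space_iff[OF Om])
    have "extension_op Q (copy v c f) (x, t) = integral\<^sup>L lebesgue ?F"
      unfolding extension_op_cis by (subst integral_restrict_space[OF Om]) simp
    also have "\<dots> = c ^ CARD('n) *\<^sub>R (LINT \<xi>|lebesgue. ?F (v + c *\<^sub>R \<xi>))"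
      using v by (subst integral_lebesgue_affine[OF Fm, of c v]) simp_all
    also have "(\<lambda>\<xi>. ?F (v + c *\<^sub>R \<xi>)) = (\<lambda>\<xi>. cis (x \<bullet> v + t * Q v) *
        (indicator Omega \<xi> *\<^sub>R (f \<xi> * cis (((c * t) *\<^sub>R w + c *\<^sub>R x) \<bullet> \<xi> + (c\<^sup>2 * t) * Q \<xi>))))"
    proof
      fix \<xi>
      have ph: "x \<bullet> (v + c *\<^sub>R \<xi>) + t * Q (v + c *\<^sub>R \<xi>)
          = (x \<bullet> v + t * Q v) + (((c * t) *\<^sub>R w + c *\<^sub>R x) \<bullet> \<xi> + (c\<^sup>2 * t) * Q \<xi>)"
        unfolding w by (simp add: inner_add_left inner_add_right algebra_simps)
      show "?F (v + c *\<^sub>R \<xi>) = cis (x \<bullet> v + t * Q v) *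
        (indicator Omega \<xi> *\<^sub>R (f \<xi> * cis (((c * t) *\<^sub>R w + c *\<^sub>R x) \<bullet> \<xi> + (c\<^sup>2 * t) * Q \<xi>)))"
        using v affine_in_Omega[OF v] unfolding ph cis_mult[symmetric]
        by (simp add: copy_affine indicator_def)
    qed
    also have "(LINT \<xi>|lebesgue. cis (x \<bullet> v + t * Q v) *
        (indicator Omega \<xi> *\<^sub>R (f \<xi> * cis (((c * t) *\<^sub>R w + c *\<^sub>R x) \<bullet> \<xi> + (c\<^sup>2 * t) * Q \<xi>))))
      = cis (x \<bullet> v + t * Q v) * extension_op Q f ((c * t) *\<^sub>R w + c *\<^sub>R x, c\<^sup>2 * t)"
      unfolding extension_op_cis integral_restrict_space[OF Om] by (rule integral_mult_right_zero)
    finally show ?thesis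
      using v by (simp add: norm_mult)
  qed
  then show ?thesis by blast
qed

text \<open>On each slice the Galilean shift is a translation and does not change the integral. The
  Jacobians of the scalings in space and time would contribute further factors \<open>c^(-n)\<close>
  and \<open>c^(-2)\<close>; both are at least 1 and are dropped.\<close>

lemma energy_copy_ge:
  fixes Q :: "real^'n \<Rightarrow> real" and p :: real
  assumes Q: "quadratic_form Q" and f: "f \<in> D" and v: "0 < c" "c \<le> 1" "v \<in> cbox 0 ((1 - c) *\<^sub>R 1)"
    and p: "p > 0"
  shows "ennreal (c powr (CARD('n) * p)) * energy Q p R f \<le> energy Q p (R / c\<^sup>2) (copy v c f)"
proof -
  obtain w where w: "\<forall>x t. norm (extension_op Q (copy v c f) (x, t))
      = c ^ CARD('n) * norm (extension_op Q f ((c * t) *\<^sub>R w + c *\<^sub>R x, c\<^sup>2 * t))"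
    using extension_op_copy[OF Q f v] by (rule exE)
  have Qm: "Q \<in> borel_measurable borel"
    using quadratic_form_continuous[OF Q] by (rule borel_measurable_continuous_onI)
  note em = extension_op_measurable[OF Qm D_measurable[OF f]]
  let ?e = "\<lambda>x t. ennreal (norm (extension_op Q f (x, t)) powr p)"
  have em1: "(\<lambda>x. ?e x t) \<in> borel_measurable borel" for t
    using em by (measurable)
  have em2 [measurable]: "extension_op Q f \<in> borel_measurable (borel \<Otimes>\<^sub>M borel)"
    using em by (simp only: borel_prod)
  define I where "I t = (\<integral>\<^sup>+x. ?e x t \<partial>lborel)" for t
  have Im: "I \<in> borel_measurable borel"
    unfolding I_def[abs_def] by measurable
  have slice: "ennreal (c powr (CARD('n) * p)) * I (c\<^sup>2 * t)
      \<le> (\<integral>\<^sup>+x. ennreal (norm (extension_op Q (copy v c f) (x, t)) powr p) \<partial>lborel)" for t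
  proof -
    have "I (c\<^sup>2 * t) = ennreal (c ^ CARD('n)) * (\<integral>\<^sup>+x. ?e ((c * t) *\<^sub>R w + c *\<^sub>R x) (c\<^sup>2 * t) \<partial>lborel)"
      unfolding I_def using v
      by (subst nn_integral_lborel_affine[OF em1, of c _ "(c * t) *\<^sub>R w"]) simp_all
    also have "\<dots> \<le> 1 * (\<integral>\<^sup>+x. ?e ((c * t) *\<^sub>R w + c *\<^sub>R x) (c\<^sup>2 * t) \<partial>lborel)"
      using v by (intro mult_right_mono) (auto simp: power_le_one)
    finally have "I (c\<^sup>2 * t) \<le> (\<integral>\<^sup>+x. ?e ((c * t) *\<^sub>R w + c *\<^sub>R x) (c\<^sup>2 * t) \<partial>lborel)"
      by simp
    then have "ennreal (c powr (CARD('n) * p)) * I (c\<^sup>2 * t)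
        \<le> ennreal (c powr (CARD('n) * p)) * (\<integral>\<^sup>+x. ?e ((c * t) *\<^sub>R w + c *\<^sub>R x) (c\<^sup>2 * t) \<partial>lborel)"
      by (intro mult_left_mono) auto
    also have "\<dots> = (\<integral>\<^sup>+x. ennreal (c powr (CARD('n) * p)) * ?e ((c * t) *\<^sub>R w + c *\<^sub>R x) (c\<^sup>2 * t) \<partial>lborel)"
      using em1 by (intro nn_integral_cmult[symmetric]) measurable
    also have "\<dots> = (\<integral>\<^sup>+x. ennreal (norm (extension_op Q (copy v c f) (x, t)) powr p) \<partial>lborel)"
      using v by (intro nn_integral_cong)
        (simp add: w powr_mult powr_powr[symmetric] powr_realpow ennreal_mult)
    finally show ?thesis .
  qed
  let ?G = "\<lambda>s. indicator {-R..R} s * I s"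
  have G_m [measurable]: "?G \<in> borel_measurable borel"
    using Im by measurable
  have "c\<^sup>2 \<noteq> 0"
    using v by simp
  have "energy Q p R f = (\<integral>\<^sup>+s. ?G s \<partial>lborel)"
    unfolding energy_iterated[OF Qm D_measurable[OF f]] I_def ..
  also have "\<dots> = ennreal (c\<^sup>2) * (\<integral>\<^sup>+t. ?G (0 + c\<^sup>2 * t) \<partial>lborel)"
    using nn_integral_real_affine[OF G_m \<open>c\<^sup>2 \<noteq> 0\<close>, of 0] unfolding abs_power2 .
  also have "\<dots> \<le> 1 * (\<integral>\<^sup>+t. ?G (0 + c\<^sup>2 * t) \<partial>lborel)"
    using v by (intro mult_right_mono) (auto simp: power_le_one)
  finally have "energy Q p R f \<le> (\<integral>\<^sup>+t. ?G (0 + c\<^sup>2 * t) \<partial>lborel)"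
    unfolding mult_1 .
  then have "ennreal (c powr (CARD('n) * p)) * energy Q p R f
      \<le> ennreal (c powr (CARD('n) * p)) * (\<integral>\<^sup>+t. ?G (0 + c\<^sup>2 * t) \<partial>lborel)"
    by (rule mult_left_mono) simp
  also have "\<dots> = (\<integral>\<^sup>+t. ennreal (c powr (CARD('n) * p)) * ?G (0 + c\<^sup>2 * t) \<partial>lborel)"
    by (rule nn_integral_cmult[symmetric]) measurable
  also have "\<dots> \<le> (\<integral>\<^sup>+t. indicator {-(R / c\<^sup>2)..R / c\<^sup>2} t *
      (\<integral>\<^sup>+x. ennreal (norm (extension_op Q (copy v c f) (x, t)) powr p) \<partial>lborel) \<partial>lborel)"
  proof (rule nn_integral_mono)
    fix t
    have "0 + c\<^sup>2 * t \<in> {-R..R} \<longleftrightarrow> t \<in> {-(R / c\<^sup>2)..R / c\<^sup>2}"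
      using v by (simp add: field_simps)
    then show "ennreal (c powr (CARD('n) * p)) * ?G (0 + c\<^sup>2 * t) \<le> indicator {-(R / c\<^sup>2)..R / c\<^sup>2} t *
      (\<integral>\<^sup>+x. ennreal (norm (extension_op Q (copy v c f) (x, t)) powr p) \<partial>lborel)"
      using slice[of t] by (cases "t \<in> {-(R / c\<^sup>2)..R / c\<^sup>2}") (simp_all add: indicator_def)
  qed
  also have "\<dots> = energy Q p (R / c\<^sup>2) (copy v c f)"
    using copy_in_D[OF _ f, of c v] v
    by (intro energy_iterated[OF Qm D_measurable, symmetric]) auto
  finally show ?thesis .
qed

subsection \<open>Sums of extensions\<close>

lemma powr_convex_nonneg:
  fixes x y t p :: real
  assumes "p \<ge> 1" "x \<ge> 0" "y \<ge> 0" "0 \<le> t" "t \<le> 1"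
  shows "((1 - t) * x + t * y) powr p \<le> (1 - t) * x powr p + t * y powr p"
proof -
  \<comment> \<open>If one of \<open>x\<close>, \<open>y\<close> vanishes, the claim reduces to this
    bound on the weight; the case of two positive arguments is ordinary convexity.\<close>
  have le: "s powr p \<le> s" if "0 \<le> s" "s \<le> 1" for s :: real
    using powr_mono'[of 1 p s] that assms(1) by simp
  consider "x = 0" | "y = 0" | "x > 0" "y > 0"
    using assms by linarith
  then show ?thesis
  proof cases
    case 1
    then show ?thesis
      using assms le[of t] by (simp add: powr_mult mult_right_mono)
  next
    case 2
    then show ?thesis
      using assms le[of "1 - t"] by (simp add: powr_mult mult_right_mono)
  next
    case 3
    then show ?thesis
      using convex_onD[OF powr_convex[OF assms(1)], of t x y] assms by simp
  qed
qed

lemma powr_le_powr_iff: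
  fixes x y p :: real
  assumes "p > 0" "x \<ge> 0" "y \<ge> 0"
  shows "x powr p \<le> y powr p \<longleftrightarrow> x \<le> y"
  using powr_mono2[of p x y] powr_less_mono2[of p y x] assms by linarith

text \<open>The sum of the norms is the convex combination, with weights \<open>1 - s\<close> and
  \<open>s\<close>, of \<open>norm a / (1 - s)\<close> and \<open>norm b / s\<close>. For small
  \<open>s\<close> the coefficient of \<open>a\<close> is close to 1, at the price of a large
  coefficient for \<open>b\<close>.\<close>

lemma norm_add_powr_le:
  fixes a b :: "'a::real_normed_vector" and p s :: real
  assumes "p \<ge> 1" "0 < s" "s < 1"
  shows "norm (a + b) powr p \<le> (1 - s) powr (1 - p) * norm a powr p + s powr (1 - p) * norm b powr p"
proof -
  have w: "r * (u / r) powr p = r powr (1 - p) * u powr p" if "r > 0" "u \<ge> 0" for r u :: real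
    using that by (simp add: powr_divide powr_diff)
  have "norm (a + b) powr p \<le> (norm a + norm b) powr p"
    using assms by (intro powr_mono2 norm_triangle_ineq) auto
  also have "norm a + norm b = (1 - s) * (norm a / (1 - s)) + s * (norm b / s)"
    using assms by simp
  also have "\<dots> powr p \<le> (1 - s) * (norm a / (1 - s)) powr p + s * (norm b / s) powr p"
    using assms by (intro powr_convex_nonneg) auto
  finally show ?thesis
    using assms by (simp add: w)
qed

text \<open>Split off one factor from each power and enlarge the remaining \<open>r - 1\<close>
  powers to that of \<open>x + y\<close>.\<close>

lemma powr_superadditive:
  fixes x y r :: real
  assumes "r \<ge> 1" "x \<ge> 0" "y \<ge> 0"
  shows "x powr r + y powr r \<le> (x + y) powr r"
proof -
  have split: "u powr r = u * u powr (r - 1)" if "u \<ge> 0" for u :: real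
    using that by (cases "u = 0") (auto simp: powr_diff)
  have "x powr r + y powr r = x * x powr (r - 1) + y * y powr (r - 1)"
    using assms split by simp
  also have "\<dots> \<le> x * (x + y) powr (r - 1) + y * (x + y) powr (r - 1)"
    using assms by (intro add_mono mult_left_mono powr_mono2) auto
  also have "\<dots> = (x + y) powr r"
    using assms by (simp add: split[of "x + y"] algebra_simps)
  finally show ?thesis .
qed

text \<open>With exponent \<open>p / 2 \<ge> 1\<close> acting on squared norms: superadditivity,
  then the parallelogram law, then convexity.\<close>

lemma clarkson:
  fixes a b :: "'a::real_inner" and p :: real
  assumes "p \<ge> 2"
  shows "2 * (norm a powr p + norm b powr p) \<le> norm (a + b) powr p + norm (a - b) powr p"
proof -
  have sq: "norm c powr p = ((norm c)\<^sup>2) powr (p / 2)" for c :: 'a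
    by (simp add: powr_numeral[symmetric] powr_powr del: powr_numeral)
  have par: "(norm (a + b))\<^sup>2 + (norm (a - b))\<^sup>2 = 2 * ((norm a)\<^sup>2 + (norm b)\<^sup>2)"
    by (simp add: power2_norm_eq_inner inner_add inner_diff inner_commute)
  have "norm a powr p + norm b powr p \<le> ((norm a)\<^sup>2 + (norm b)\<^sup>2) powr (p / 2)"
    unfolding sq using assms by (intro powr_superadditive) auto
  also have "(norm a)\<^sup>2 + (norm b)\<^sup>2 = (1 - 1 / 2) * (norm (a + b))\<^sup>2 + 1 / 2 * (norm (a - b))\<^sup>2"
    using par by simp
  also have "\<dots> powr (p / 2) \<le> (1 - 1 / 2) * ((norm (a + b))\<^sup>2) powr (p / 2) + 1 / 2 * ((norm (a - b))\<^sup>2) powr (p / 2)"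
    using assms by (intro powr_convex_nonneg) auto
  finally show ?thesis
    unfolding sq by simp
qed

section \<open>Energies of sums, differences and larger slabs\<close>

lemma extension_op_add:
  assumes "Q \<in> borel_measurable borel" "f \<in> D" "g \<in> D"
  shows "extension_op Q (\<lambda>\<xi>. f \<xi> + g \<xi>) z = extension_op Q f z + extension_op Q g z"
    and "extension_op Q (\<lambda>\<xi>. f \<xi> - g \<xi>) z = extension_op Q f z - extension_op Q g z"
  using extension_op_integrable[OF assms(1,2)] extension_op_integrable[OF assms(1,3)]
  by (cases z; simp add: extension_op_cis ring_distribs)+

lemma extension_op_powr_measurable:
  assumes "Q \<in> borel_measurable borel" "f \<in> borel_measurable (lebesgue_on Omega)"
  shows "(\<lambda>z. ennreal (norm (extension_op Q f z) powr p)) \<in> borel_measurable (lebesgue_on (T R))"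
proof -
  note [measurable] = extension_op_measurable[OF assms]
  have "(\<lambda>z. ennreal (norm (extension_op Q f z) powr p)) \<in> borel_measurable borel"
    by measurable
  then show ?thesis
    by (intro measurable_restrict_space1 measurable_completion) simp
qed

lemma energy_add_diff_ge:
  assumes Q: "Q \<in> borel_measurable borel" and f: "f \<in> D" and g: "g \<in> D" and p: "p \<ge> 2"
  shows "2 * (energy Q p R f + energy Q p R g)
    \<le> energy Q p R (\<lambda>\<xi>. f \<xi> + g \<xi>) + energy Q p R (\<lambda>\<xi>. f \<xi> - g \<xi>)"
proof -
  let ?e = "\<lambda>f z. ennreal (norm (extension_op Q f z) powr p)"
  note m = extension_op_powr_measurable[OF Q D_measurable[OF f], of p R]
    extension_op_powr_measurable[OF Q D_measurable[OF g], of p R]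
  note add_m = extension_op_powr_measurable[OF Q borel_measurable_add[OF D_measurable[OF f] D_measurable[OF g]], of p R]
  note diff_m = extension_op_powr_measurable[OF Q borel_measurable_diff[OF D_measurable[OF f] D_measurable[OF g]], of p R]
  have "2 * (energy Q p R f + energy Q p R g) = (\<integral>\<^sup>+z. 2 * (?e f z + ?e g z) \<partial>lebesgue_on (T R))"
    unfolding energy_def
    by (simp only: nn_integral_cmult[OF borel_measurable_add[OF m]] nn_integral_add[OF m])
  also have "\<dots> \<le> (\<integral>\<^sup>+z. ?e (\<lambda>\<xi>. f \<xi> + g \<xi>) z + ?e (\<lambda>\<xi>. f \<xi> - g \<xi>) z \<partial>lebesgue_on (T R))"
  proof (rule nn_integral_mono)
    fix z
    have "2 * (?e f z + ?e g z) = ennreal (2 * (norm (extension_op Q f z) powr p + norm (extension_op Q g z) powr p))"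
      by (simp only: ennreal_mult'[of 2, simplified] ennreal_plus powr_ge_zero)
    also have "\<dots> \<le> ennreal (norm (extension_op Q f z + extension_op Q g z) powr p
        + norm (extension_op Q f z - extension_op Q g z) powr p)"
      by (intro ennreal_leI clarkson p)
    finally show "2 * (?e f z + ?e g z) \<le> ?e (\<lambda>\<xi>. f \<xi> + g \<xi>) z + ?e (\<lambda>\<xi>. f \<xi> - g \<xi>) z"
      unfolding extension_op_add[OF Q f g] by simp
  qed
  also have "\<dots> = energy Q p R (\<lambda>\<xi>. f \<xi> + g \<xi>) + energy Q p R (\<lambda>\<xi>. f \<xi> - g \<xi>)"
    unfolding energy_def by (rule nn_integral_add[OF add_m diff_m])
  finally show ?thesis .
qed

lemma energy_add_le:
  assumes Q: "Q \<in> borel_measurable borel" and f: "f \<in> D" and g: "g \<in> D"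
    and p: "p \<ge> 1" and s: "0 < s" "s < 1"
  shows "energy Q p R (\<lambda>\<xi>. f \<xi> + g \<xi>)
    \<le> ennreal ((1 - s) powr (1 - p)) * energy Q p R f + ennreal (s powr (1 - p)) * energy Q p R g"
proof -
  let ?e = "\<lambda>f z. ennreal (norm (extension_op Q f z) powr p)"
  note m = extension_op_powr_measurable[OF Q D_measurable[OF f], of p R]
    extension_op_powr_measurable[OF Q D_measurable[OF g], of p R]
  have "energy Q p R (\<lambda>\<xi>. f \<xi> + g \<xi>)
      \<le> (\<integral>\<^sup>+z. ennreal ((1 - s) powr (1 - p)) * ?e f z + ennreal (s powr (1 - p)) * ?e g z \<partial>lebesgue_on (T R))"
    unfolding energy_def
  proof (rule nn_integral_mono)
    fix z
    have "?e (\<lambda>\<xi>. f \<xi> + g \<xi>) z \<le> ennreal ((1 - s) powr (1 - p) * norm (extension_op Q f z) powr p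
        + s powr (1 - p) * norm (extension_op Q g z) powr p)"
      unfolding extension_op_add[OF Q f g] by (intro ennreal_leI norm_add_powr_le p s)
    then show "?e (\<lambda>\<xi>. f \<xi> + g \<xi>) z \<le> ennreal ((1 - s) powr (1 - p)) * ?e f z + ennreal (s powr (1 - p)) * ?e g z"
      by (simp add: ennreal_mult)
  qed
  also have "\<dots> = ennreal ((1 - s) powr (1 - p)) * energy Q p R f + ennreal (s powr (1 - p)) * energy Q p R g"
    unfolding energy_def
    by (subst nn_integral_add) (simp_all only: nn_integral_cmult[OF m(1)] nn_integral_cmult[OF m(2)] borel_measurable_times_ennreal borel_measurable_const m)
  finally show ?thesis .
qed

lemma energy_mono:
  fixes Q :: "real^'a \<Rightarrow> real"
  assumes "R \<le> R'"
  shows "energy Q p R f \<le> energy Q p R' f"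
proof -
  have TT: "(T r :: ((real^'a) \<times> real) set) \<inter> space lebesgue \<in> sets lebesgue" for r :: real
  proof -
    have "(T r :: ((real^'a) \<times> real) set) \<in> sets borel"
      unfolding T_def by (intro borel_Times) auto
    then show ?thesis by simp
  qed
  show ?thesis
    unfolding energy_def nn_integral_restrict_space[OF TT]
    using assms by (intro nn_integral_mono) (auto simp: T_def indicator_def)
qed

subsection \<open>The best constant\<close>

lemma Lp_norm_extension_op:
  assumes "energy Q p R f < \<infinity>"
  shows "Lp_norm p (lebesgue_on (T R)) (extension_op Q f) = ennreal (enn2real (energy Q p R f) powr (1 / p))"
  using assms by (simp add: Lp_norm_def Let_def flip: energy_def)

lemma energy_finite:
  assumes "Q \<in> borel_measurable borel" "f \<in> D" "p \<ge> 2" "R \<ge> 0"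
  shows "energy Q p R f < \<infinity>"
  using energy_le_mass[OF assms] by (rule order_le_less_trans) simp

text \<open>Raising to the power \<open>p\<close> replaces norms by energy and mass, and extended by
  ordinary reals; \<open>best_const\<close> is handled in this form from here on.\<close>

lemma Lp_norm_extension_op_le_iff:
  assumes "Q \<in> borel_measurable borel" "f \<in> D" "p \<ge> 2" "R \<ge> 0" "q > 0" "k \<ge> 0"
  shows "Lp_norm p (lebesgue_on (T R)) (extension_op Q f) \<le> ennreal k * Lp_norm q (lebesgue_on Omega) f
    \<longleftrightarrow> enn2real (energy Q p R f) \<le> k powr p * mass f powr (p / q)"
proof -
  let ?e = "enn2real (energy Q p R f)"
  have "Lp_norm p (lebesgue_on (T R)) (extension_op Q f) \<le> ennreal k * Lp_norm q (lebesgue_on Omega) f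
    \<longleftrightarrow> ?e powr (1 / p) \<le> k * mass f powr (1 / q)"
    unfolding Lp_norm_extension_op[OF energy_finite[OF assms(1-4)]] Lp_norm_D[OF assms(2,5)]
    using assms by (simp add: ennreal_mult[symmetric])
  also have "\<dots> \<longleftrightarrow> (?e powr (1 / p)) powr p \<le> (k * mass f powr (1 / q)) powr p"
    using assms by (intro powr_le_powr_iff[symmetric]) auto
  also have "(?e powr (1 / p)) powr p = ?e"
    using assms by (simp add: powr_powr)
  also have "(k * mass f powr (1 / q)) powr p = k powr p * mass f powr (p / q)"
    using assms by (simp add: powr_mult powr_powr)
  finally show ?thesis .
qed

text \<open>The energy is bounded linearly in the mass, and
  \<open>mass f \<le> mass f powr (p / q)\<close> because the mass is at most 1 and
  \<open>p \<le> q\<close>. The number \<open>k\<close> is the \<open>p\<close>-th root of the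
  constant in \<open>energy_le_mass\<close>.\<close>

lemma best_const_finite:
  fixes Q :: "real^'n \<Rightarrow> real"
  assumes "Q \<in> borel_measurable borel" "p \<ge> 2" "p \<le> q" "R \<ge> 0"
  shows "best_const Q p q R < \<infinity>"
proof -
  define k where "k = (2 * R * (2 * pi) ^ CARD('n)) powr (1 / p)"
  have "best_const Q p q R \<le> ennreal k"
    unfolding best_const_def
  proof (rule Inf_lower, clarify)
    fix f :: "real^'n \<Rightarrow> complex" assume f: "f \<in> D"
    have "enn2real (energy Q p R f) \<le> 2 * R * (2 * pi) ^ CARD('n) * mass f"
      using energy_le_mass[OF assms(1) f assms(2,4)] assms by (intro enn2real_leI) (auto simp: mass_nonneg)
    also have "mass f \<le> mass f powr (p / q)"
      using powr_mono'[of "p / q" 1 "mass f"] mass_nonneg[of f] mass_le_1[OF f] assms by simp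
    also have "2 * R * (2 * pi) ^ CARD('n) = k powr p"
      using assms by (simp add: k_def powr_powr)
    finally have "enn2real (energy Q p R f) \<le> k powr p * mass f powr (p / q)"
      using assms by (simp add: mult_left_mono)
    then show "Lp_norm p (lebesgue_on (T R)) (extension_op Q f) \<le> ennreal k * Lp_norm q (lebesgue_on Omega) f"
      using assms f by (subst Lp_norm_extension_op_le_iff) (auto simp: k_def)
  qed
  then show ?thesis
    by (rule order_le_less_trans) simp
qed

text \<open>The infimum is itself admissible: if the bound failed for \<open>f\<close>, the quotient
  \<open>k\<close> of its two norms would exceed the infimum, and an admissible constant below
  \<open>k\<close> would contradict the definition of \<open>k\<close>.\<close>

lemma energy_le_best_const:
  assumes Q: "Q \<in> borel_measurable borel" and pq: "p \<ge> 2" "p \<le> q" and R: "R \<ge> 0" and f: "f \<in> D"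
  shows "enn2real (energy Q p R f) \<le> enn2real (best_const Q p q R) powr p * mass f powr (p / q)"
proof (rule ccontr)
  let ?e = "enn2real (energy Q p R f)" and ?K = "enn2real (best_const Q p q R)"
  assume "\<not> ?thesis"
  then have less: "?K powr p * mass f powr (p / q) < ?e"
    by simp
  have "mass f \<noteq> 0"
  proof
    assume "mass f = 0"
    then have "?e = 0"
      using energy_le_mass[OF Q f pq(1) R] by simp
    moreover have "0 \<le> ?K powr p * mass f powr (p / q)"
      by simp
    ultimately show False
      using less by linarith
  qed
  then have m: "mass f powr (p / q) > 0"
    using mass_nonneg[of f] by simp
  define k where "k = (?e / mass f powr (p / q)) powr (1 / p)"
  have kp: "k powr p = ?e / mass f powr (p / q)"
    using pq m by (simp add: k_def powr_powr)
  have "?K powr p < k powr p"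
    using less m by (simp add: kp field_simps)
  then have "?K < k"
    using pq powr_mono2[of p k ?K] by (force simp: k_def not_less[symmetric])
  then have "best_const Q p q R < ennreal k"
    using best_const_finite[OF Q pq R] by (cases "best_const Q p q R") (auto simp: ennreal_less_iff)
  then obtain C where C: "C < ennreal k"
    "Lp_norm p (lebesgue_on (T R)) (extension_op Q f) \<le> C * Lp_norm q (lebesgue_on Omega) f"
    unfolding best_const_def Inf_less_iff using f by auto
  define c where "c = enn2real C"
  have c: "C = ennreal c" "c \<ge> 0" "c < k"
    using C(1) by (cases C; auto simp: c_def ennreal_less_iff)+
  have "?e \<le> c powr p * mass f powr (p / q)"
    using C(2) c pq R by (subst (asm) c(1), subst (asm) Lp_norm_extension_op_le_iff[OF Q f]) auto
  also have "\<dots> < k powr p * mass f powr (p / q)"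
    using m c pq by (intro mult_strict_right_mono powr_less_mono2) auto
  also have "\<dots> = ?e"
    using m by (simp add: kp)
  finally show False by simp
qed

text \<open>Otherwise \<open>k\<close> would be admissible and the infimum could not exceed
  it.\<close>

lemma near_extremiser:
  assumes Q: "Q \<in> borel_measurable borel" and pq: "p \<ge> 2" "p \<le> q" and R: "R \<ge> 0"
    and k: "0 \<le> k" "k < enn2real (best_const Q p q R)"
  shows "\<exists>f\<in>D. k powr p * mass f powr (p / q) < enn2real (energy Q p R f)"
proof (rule ccontr)
  assume contra: "\<not> ?thesis"
  have "best_const Q p q R \<le> ennreal k"
    unfolding best_const_def
  proof (rule Inf_lower, clarify)
    fix f :: "real^'a \<Rightarrow> complex" assume "f \<in> D"
    then show "Lp_norm p (lebesgue_on (T R)) (extension_op Q f) \<le> ennreal k * Lp_norm q (lebesgue_on Omega) f"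
      using contra pq R k by (subst Lp_norm_extension_op_le_iff[OF Q]) (auto simp: not_less)
  qed
  then have "enn2real (best_const Q p q R) \<le> k"
    using k by (intro enn2real_leI) auto
  then show False
    using k by simp
qed

subsection \<open>Adding copies\<close>

definition restr :: "(real^'n) set \<Rightarrow> (real^'n \<Rightarrow> complex) \<Rightarrow> real^'n \<Rightarrow> complex" where
  "restr P f \<xi> = (if \<xi> \<in> P then f \<xi> else 0)"

lemma restr_in_D:
  assumes f: "f \<in> D" and P: "P \<in> sets lebesgue"
  shows "restr P f \<in> D"
proof -
  have "restr P f \<in> borel_measurable (lebesgue_on Omega)"
    unfolding restr_def[abs_def]
  proof (rule measurable_If_set[OF D_measurable[OF f] measurable_const])
    show "P \<inter> space (lebesgue_on Omega) \<in> sets (lebesgue_on Omega)"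
      using P by (auto simp: sets_restrict_space)
  qed simp
  then show ?thesis
    using f by (auto simp: D_def restr_def)
qed

lemma measure_Un_disjoint:
  assumes "A \<in> fmeasurable M" "B \<in> fmeasurable M" "A \<inter> B = {}"
  shows "measure M (A \<union> B) = measure M A + measure M B"
  using measure_Un3[OF assms(1,2)] assms(3) by simp

lemma mass_restr_add:
  assumes f: "f \<in> D" and P: "P \<in> sets lebesgue"
  shows "mass f = mass (restr P f) + mass (restr (- P) f)"
proof -
  have "- P \<in> sets lebesgue"
    using sets.compl_sets[OF P] by (simp add: Compl_eq_Diff_UNIV)
  note D = D_support_lmeasurable[OF restr_in_D[OF f P]] D_support_lmeasurable[OF restr_in_D[OF f this]]
  have "{\<xi>\<in>Omega. f \<xi> \<noteq> 0} = {\<xi>\<in>Omega. restr P f \<xi> \<noteq> 0} \<union> {\<xi>\<in>Omega. restr (- P) f \<xi> \<noteq> 0}"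
    by (auto simp: restr_def)
  then show ?thesis
    unfolding mass_def by (simp only:) (rule measure_Un_disjoint[OF D], auto simp: restr_def)
qed

text \<open>Disjoint supports keep the values 0 or unimodular, whichever sign is chosen; this leaves
  the sign free for Clarkson's inequality.\<close>

lemma D_add_disjoint:
  assumes g: "g \<in> D" and h: "h \<in> D" and disj: "\<And>\<xi>. \<xi> \<in> Omega \<Longrightarrow> g \<xi> = 0 \<or> h \<xi> = 0"
  shows "(\<lambda>\<xi>. g \<xi> + h \<xi>) \<in> D" "mass (\<lambda>\<xi>. g \<xi> + h \<xi>) = mass g + mass h"
    and "(\<lambda>\<xi>. g \<xi> - h \<xi>) \<in> D" "mass (\<lambda>\<xi>. g \<xi> - h \<xi>) = mass g + mass h"
proof -
  show "(\<lambda>\<xi>. g \<xi> + h \<xi>) \<in> D" "(\<lambda>\<xi>. g \<xi> - h \<xi>) \<in> D"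
    using borel_measurable_add[OF D_measurable[OF g] D_measurable[OF h]]
      borel_measurable_diff[OF D_measurable[OF g] D_measurable[OF h]] g h disj
    by (fastforce simp: D_def)+
  have nz: "g \<xi> + h \<xi> \<noteq> 0 \<longleftrightarrow> g \<xi> \<noteq> 0 \<or> h \<xi> \<noteq> 0" "g \<xi> - h \<xi> \<noteq> 0 \<longleftrightarrow> g \<xi> \<noteq> 0 \<or> h \<xi> \<noteq> 0"
    if "\<xi> \<in> Omega" for \<xi>
    using disj[OF that] by auto
  have "{\<xi>\<in>Omega. g \<xi> + h \<xi> \<noteq> 0} = {\<xi>\<in>Omega. g \<xi> \<noteq> 0} \<union> {\<xi>\<in>Omega. h \<xi> \<noteq> 0}"
       "{\<xi>\<in>Omega. g \<xi> - h \<xi> \<noteq> 0} = {\<xi>\<in>Omega. g \<xi> \<noteq> 0} \<union> {\<xi>\<in>Omega. h \<xi> \<noteq> 0}"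
    using nz by auto
  moreover have "measure lebesgue ({\<xi>\<in>Omega. g \<xi> \<noteq> 0} \<union> {\<xi>\<in>Omega. h \<xi> \<noteq> 0}) = mass g + mass h"
    unfolding mass_def using disj
    by (intro measure_Un_disjoint D_support_lmeasurable g h) auto
  ultimately show "mass (\<lambda>\<xi>. g \<xi> + h \<xi>) = mass g + mass h" "mass (\<lambda>\<xi>. g \<xi> - h \<xi>) = mass g + mass h"
    by (simp_all only: mass_def)
qed

lemma measure_cbox_scaleR_1:
  assumes "a \<ge> 0"
  shows "measure lebesgue (cbox 0 (a *\<^sub>R (1::real^'n))) = a ^ CARD('n)"
proof -
  have "0 \<in> cbox 0 (a *\<^sub>R (1::real^'n))"
    using assms by (simp add: mem_box_cart)
  then have "cbox 0 (a *\<^sub>R (1::real^'n)) \<noteq> {}"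
    by blast
  then show ?thesis
    by (simp add: content_cbox_if_cart)
qed

text \<open>One round of the construction. The energy gained is, up to a factor tending to 1 as
  \<open>\<rho>\<close> tends to 1, the bound \<open>K powr p * mass f powr (p / q)\<close> that an
  exact extremiser would attain. The same \<open>f\<close> can be reused in every round as long as
  the mass of \<open>g\<close> stays below the threshold.\<close>

lemma add_copy_step:
  fixes Q :: "real^'n \<Rightarrow> real" and p q R \<rho> K :: real
  assumes Q: "quadratic_form Q" and pq: "p \<ge> 2" "p \<le> q" and R: "R \<ge> 0"
    and \<rho>: "0 < \<rho>" "\<rho> < 1"
    and K: "K = enn2real (best_const Q p q R)"
    and f: "f \<in> D" "\<rho> powr p * K powr p * mass f powr (p / q) \<le> enn2real (energy Q p R f)"
    and g: "g \<in> D" "mass g \<le> (1 - \<rho>) powr q * (1 - \<rho>) ^ CARD('n)"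
  shows "\<exists>g'\<in>D. mass g + \<rho> ^ CARD('n) * (1 - (1 - \<rho>) powr q) * mass f \<le> mass g' \<and>
    mass g' \<le> mass g + \<rho> ^ CARD('n) * mass f \<and>
    enn2real (energy Q p (R / \<rho>\<^sup>2) g) + \<rho> powr (CARD('n) * p) * (\<rho> powr (p - 1) * (\<rho> powr p - (1 - \<rho>))) *
        (K powr p * mass f powr (p / q))
      \<le> enn2real (energy Q p (R / \<rho>\<^sup>2) g')"
proof -
  have Qm: "Q \<in> borel_measurable borel"
    using quadratic_form_continuous[OF Q] by (rule borel_measurable_continuous_onI)
  let ?S = "{\<xi>\<in>Omega. f \<xi> \<noteq> 0}" and ?F = "{\<xi>\<in>Omega. g \<xi> \<noteq> 0}"
  let ?n = "CARD('n)"
  let ?e = "\<lambda>r f. enn2real (energy Q p r f)"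
  have Sm: "?S \<in> lmeasurable" and Fm: "?F \<in> lmeasurable"
    using f g by (auto intro: D_support_lmeasurable)
  \<comment> \<open>Read off from the copy with \<open>v = 0\<close>, whose support is the shrunken
    support of \<open>f\<close>.\<close>
  have \<rho>Sm: "(*\<^sub>R) \<rho> ` ?S \<in> lmeasurable" "measure lebesgue ((*\<^sub>R) \<rho> ` ?S) = \<rho> ^ ?n * mass f"
    using D_support_lmeasurable[OF copy_in_D[of \<rho> f 0]] copy_support[of \<rho> 0 f] copy_mass[of \<rho> 0 f] f(1) \<rho>
    by (simp_all add: mass_def mem_box_cart)
  have cb: "measure lebesgue (cbox 0 ((1 - \<rho>) *\<^sub>R (1::real^'n))) = (1 - \<rho>) ^ ?n"
    using \<rho> by (intro measure_cbox_scaleR_1) simp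
  obtain v where v: "v \<in> cbox 0 ((1 - \<rho>) *\<^sub>R (1::real^'n))"
    "measure lebesgue ((+) v ` (*\<^sub>R) \<rho> ` ?S \<inter> ?F) * (1 - \<rho>) ^ ?n \<le> \<rho> ^ ?n * mass f * mass g"
    using exists_small_overlap[OF \<rho>Sm(1) Fm, of 0 "(1 - \<rho>) *\<^sub>R 1"] \<rho>
    unfolding cb \<rho>Sm(2) by (auto simp: mass_def)
  \<comment> \<open>The points of the parameter domain of \<open>f\<close> that the copy would send
    into the support of \<open>g\<close>; \<open>f\<close> is split into \<open>f2\<close> on
    \<open>P\<close>, to be deleted, and \<open>f1\<close> off \<open>P\<close>.\<close>
  define P where "P = {\<xi>. v + \<rho> *\<^sub>R \<xi> \<in> ?F}"
  have P: "P \<in> sets lebesgue"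
  proof -
    have "(\<lambda>\<xi>. v + \<rho> *\<^sub>R \<xi>) -` ?F \<inter> space lebesgue \<in> sets lebesgue"
      using \<rho> fmeasurableD[OF Fm] by (intro measurable_sets[OF lebesgue_affine_scaleR(2)]) auto
    then show ?thesis by (simp add: P_def vimage_def)
  qed
  then have P': "- P \<in> sets lebesgue"
    using sets.compl_sets[OF P] by (simp add: Compl_eq_Diff_UNIV)
  define f1 where "f1 = restr (- P) f"
  define f2 where "f2 = restr P f"
  have f1: "f1 \<in> D" and f2: "f2 \<in> D"
    unfolding f1_def f2_def by (intro restr_in_D f P P')+
  have f12: "f = (\<lambda>\<xi>. f1 \<xi> + f2 \<xi>)"
    by (auto simp: f1_def f2_def restr_def)
  have mf: "mass f = mass f2 + mass f1"
    unfolding f1_def f2_def by (rule mass_restr_add[OF f(1) P])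
  \<comment> \<open>The threshold on \<open>mass g\<close> is made for this: its factor
    \<open>(1 - \<rho>) ^ n\<close> cancels the measure of the box of translations, and
    \<open>(1 - \<rho>) powr q\<close> remains as the fraction lost.\<close>
  have f2_mass: "mass f2 \<le> (1 - \<rho>) powr q * mass f"
  proof -
    have "(\<lambda>\<xi>. \<rho> *\<^sub>R \<xi> + v) ` {\<xi>\<in>Omega. f2 \<xi> \<noteq> 0} = (+) v ` (*\<^sub>R) \<rho> ` ?S \<inter> ?F"
      by (auto simp: f2_def restr_def P_def image_image add.commute split: if_splits)
    then have "\<rho> ^ ?n * mass f2 = measure lebesgue ((+) v ` (*\<^sub>R) \<rho> ` ?S \<inter> ?F)"
      using \<rho> measure_lebesgue_affine[of \<rho> v "{\<xi>\<in>Omega. f2 \<xi> \<noteq> 0}"] by (simp add: mass_def)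
    then have "\<rho> ^ ?n * mass f2 * (1 - \<rho>) ^ ?n \<le> \<rho> ^ ?n * mass f * mass g"
      using v(2) by simp
    also have "\<dots> \<le> \<rho> ^ ?n * mass f * ((1 - \<rho>) powr q * (1 - \<rho>) ^ ?n)"
      using g \<rho> by (intro mult_left_mono) (auto simp: mass_nonneg)
    finally have "(\<rho> ^ ?n * (1 - \<rho>) ^ ?n) * mass f2 \<le> (\<rho> ^ ?n * (1 - \<rho>) ^ ?n) * ((1 - \<rho>) powr q * mass f)"
      by (simp only: mult_ac)
    then show ?thesis
      using \<rho> by (subst (asm) mult_le_cancel_left_pos) auto
  qed
  define h where "h = copy v \<rho> f1"
  have h: "h \<in> D"
    unfolding h_def using \<rho> by (intro copy_in_D f1) simp
  have h_mass: "mass h = \<rho> ^ ?n * mass f1"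
    unfolding h_def using \<rho> v by (intro copy_mass) auto
  have disj: "g \<eta> = 0 \<or> h \<eta> = 0" if "\<eta> \<in> Omega" for \<eta>
    using that \<rho> by (auto simp: h_def copy_def Let_def f1_def restr_def P_def)
  have R1: "R / \<rho>\<^sup>2 \<ge> 0"
    using R by simp
  have fin: "energy Q p r u < \<infinity>" if "r \<ge> 0" "u \<in> D" for r u
    by (rule energy_finite[OF Qm that(2) pq(1) that(1)])
  have eK: "ennreal (?e r u) = energy Q p r u" if "r \<ge> 0" "u \<in> D" for r u
    using fin[OF that] by simp
  have f1_energy: "\<rho> powr (p - 1) * (\<rho> powr p - (1 - \<rho>)) * (K powr p * mass f powr (p / q)) \<le> ?e R f1"
  proof -
    let ?M = "K powr p * mass f powr (p / q)"
    \<comment> \<open>The weight is \<open>s = 1 - \<rho>\<close>. The lost fraction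
      \<open>(1 - \<rho>) powr q\<close> becomes \<open>(1 - \<rho>) powr p\<close> in the energy of
      \<open>f2\<close>, and multiplied by the coefficient \<open>(1 - \<rho>) powr (1 - p)\<close>
      it leaves only \<open>1 - \<rho>\<close>.\<close>
    have "energy Q p R f \<le> ennreal ((1 - (1 - \<rho>)) powr (1 - p)) * energy Q p R f1
        + ennreal ((1 - \<rho>) powr (1 - p)) * energy Q p R f2"
      unfolding f12 using pq \<rho> by (intro energy_add_le Qm f1 f2) auto
    then have "ennreal (?e R f) \<le> ennreal (\<rho> powr (1 - p) * ?e R f1 + (1 - \<rho>) powr (1 - p) * ?e R f2)"
      using eK[OF R f(1)] eK[OF R f1] eK[OF R f2] by (simp add: ennreal_mult)
    then have 1: "?e R f \<le> \<rho> powr (1 - p) * ?e R f1 + (1 - \<rho>) powr (1 - p) * ?e R f2"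
      by (subst (asm) ennreal_le_iff) auto
    have "?e R f2 \<le> K powr p * mass f2 powr (p / q)"
      unfolding K by (rule energy_le_best_const[OF Qm pq R f2])
    also have "\<dots> \<le> K powr p * ((1 - \<rho>) powr q * mass f) powr (p / q)"
      using f2_mass pq by (intro mult_left_mono powr_mono2) (auto simp: mass_nonneg)
    also have "\<dots> = (1 - \<rho>) powr p * ?M"
      using \<rho> pq by (simp add: powr_mult powr_powr)
    finally have "(1 - \<rho>) powr (1 - p) * ?e R f2 \<le> (1 - \<rho>) powr (1 - p) * ((1 - \<rho>) powr p * ?M)"
      by (intro mult_left_mono) auto
    also have "\<dots> = (1 - \<rho>) * ?M"
      using \<rho> by (simp add: powr_add[symmetric] flip: mult.assoc)
    finally have "\<rho> powr p * ?M \<le> \<rho> powr (1 - p) * ?e R f1 + (1 - \<rho>) * ?M"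
      using 1 f(2) by (simp add: mult.assoc)
    then have "(\<rho> powr p - (1 - \<rho>)) * ?M \<le> \<rho> powr (1 - p) * ?e R f1"
      by (simp add: algebra_simps)
    then have "\<rho> powr (p - 1) * ((\<rho> powr p - (1 - \<rho>)) * ?M) \<le> \<rho> powr (p - 1) * (\<rho> powr (1 - p) * ?e R f1)"
      by (intro mult_left_mono) auto
    also have "\<dots> = ?e R f1"
      using \<rho> by (simp add: powr_add[symmetric] flip: mult.assoc)
    finally show ?thesis by (simp only: mult.assoc)
  qed
  have h_energy: "\<rho> powr (?n * p) * ?e R f1 \<le> ?e (R / \<rho>\<^sup>2) h"
  proof -
    have "ennreal (\<rho> powr (?n * p)) * energy Q p R f1 \<le> energy Q p (R / \<rho>\<^sup>2) h"
      unfolding h_def using \<rho> v(1) pq by (intro energy_copy_ge[OF Q f1, of \<rho> v p R]) simp_all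
    then have "ennreal (\<rho> powr (?n * p) * ?e R f1) \<le> ennreal (?e (R / \<rho>\<^sup>2) h)"
      using eK[OF R f1] eK[OF R1 h] by (simp add: ennreal_mult)
    then show ?thesis by (subst (asm) ennreal_le_iff) auto
  qed
  note D = D_add_disjoint[OF g(1) h disj]
  have gain: "2 * (?e (R / \<rho>\<^sup>2) g + ?e (R / \<rho>\<^sup>2) h)
      \<le> ?e (R / \<rho>\<^sup>2) (\<lambda>\<xi>. g \<xi> + h \<xi>) + ?e (R / \<rho>\<^sup>2) (\<lambda>\<xi>. g \<xi> - h \<xi>)"
  proof -
    have "2 * (energy Q p (R / \<rho>\<^sup>2) g + energy Q p (R / \<rho>\<^sup>2) h)
      \<le> energy Q p (R / \<rho>\<^sup>2) (\<lambda>\<xi>. g \<xi> + h \<xi>) + energy Q p (R / \<rho>\<^sup>2) (\<lambda>\<xi>. g \<xi> - h \<xi>)"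
      by (rule energy_add_diff_ge[OF Qm g(1) h pq(1)])
    then have "2 * (ennreal (?e (R / \<rho>\<^sup>2) g) + ennreal (?e (R / \<rho>\<^sup>2) h))
      \<le> ennreal (?e (R / \<rho>\<^sup>2) (\<lambda>\<xi>. g \<xi> + h \<xi>)) + ennreal (?e (R / \<rho>\<^sup>2) (\<lambda>\<xi>. g \<xi> - h \<xi>))"
      by (simp only: eK[OF R1 g(1)] eK[OF R1 h] eK[OF R1 D(1)] eK[OF R1 D(3)])
    then have "ennreal (2 * (?e (R / \<rho>\<^sup>2) g + ?e (R / \<rho>\<^sup>2) h))
      \<le> ennreal (?e (R / \<rho>\<^sup>2) (\<lambda>\<xi>. g \<xi> + h \<xi>) + ?e (R / \<rho>\<^sup>2) (\<lambda>\<xi>. g \<xi> - h \<xi>))"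
      by (simp only: ennreal_mult'[of 2, simplified] ennreal_plus enn2real_nonneg)
    then show ?thesis by (subst (asm) ennreal_le_iff) auto
  qed
  \<comment> \<open>Of two numbers with sum at least \<open>2 * a\<close>, one is at least
    \<open>a\<close>; this chooses the sign of \<open>h\<close>.\<close>
  have "\<exists>g'\<in>D. mass g' = mass g + mass h \<and> ?e (R / \<rho>\<^sup>2) g + ?e (R / \<rho>\<^sup>2) h \<le> ?e (R / \<rho>\<^sup>2) g'"
  proof (cases "?e (R / \<rho>\<^sup>2) g + ?e (R / \<rho>\<^sup>2) h \<le> ?e (R / \<rho>\<^sup>2) (\<lambda>\<xi>. g \<xi> + h \<xi>)")
    case True
    then show ?thesis using D(1,2) by blast
  next
    case False
    have "a \<le> y" if "\<not> a \<le> x" "2 * a \<le> x + y" for a x y :: real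
      using that by linarith
    from this[OF False gain]
    have "?e (R / \<rho>\<^sup>2) g + ?e (R / \<rho>\<^sup>2) h \<le> ?e (R / \<rho>\<^sup>2) (\<lambda>\<xi>. g \<xi> - h \<xi>)" .
    then show ?thesis using D(3,4) by blast
  qed
  then obtain g' where g': "g' \<in> D" "mass g' = mass g + mass h"
    "?e (R / \<rho>\<^sup>2) g + ?e (R / \<rho>\<^sup>2) h \<le> ?e (R / \<rho>\<^sup>2) g'"
    by blast
  have "mass h \<le> \<rho> ^ ?n * mass f"
    unfolding h_mass using \<rho> by (intro mult_left_mono) (auto simp: mf mass_nonneg)
  moreover have "\<rho> ^ ?n * ((1 - (1 - \<rho>) powr q) * mass f) \<le> mass h"
    unfolding h_mass using \<rho> mf f2_mass by (intro mult_left_mono) (auto simp: algebra_simps)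
  moreover have "\<rho> powr (?n * p) * (\<rho> powr (p - 1) * (\<rho> powr p - (1 - \<rho>)) * (K powr p * mass f powr (p / q)))
      \<le> ?e (R / \<rho>\<^sup>2) h"
    using f1_energy by (intro order_trans[OF mult_left_mono h_energy]) auto
  ultimately show ?thesis
    using g' by (intro bexI[of _ g']) (auto simp: mult.assoc)
qed

text \<open>Copies of one near-extremiser are added until the mass first passes the threshold, which
  bounds the support from below independently of \<open>R\<close>. Mass and energy are compared
  through the number of copies.\<close>

lemma large_support_extremiser:
  fixes Q :: "real^'n \<Rightarrow> real" and p q R \<rho> K :: real
  assumes Q: "quadratic_form Q" and pq: "p \<ge> 2" "p \<le> q" and R: "R \<ge> 0"
    and \<rho>: "0 < \<rho>" "\<rho> < 1" "1 - \<rho> \<le> \<rho> powr p"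
    and K: "K = enn2real (best_const Q p q R)" "K > 0"
  shows "\<exists>g\<in>D. mass g \<ge> (1 - \<rho>) powr q * (1 - \<rho>) ^ CARD('n) \<and>
    \<rho> powr (CARD('n) * p) * (\<rho> powr (p - 1) * (\<rho> powr p - (1 - \<rho>))) * (K powr p * mass g powr (p / q))
      \<le> enn2real (energy Q p (R / \<rho>\<^sup>2) g)"
proof -
  have Qm: "Q \<in> borel_measurable borel"
    using quadratic_form_continuous[OF Q] by (rule borel_measurable_continuous_onI)
  let ?n = "CARD('n)"
  let ?e = "\<lambda>f. enn2real (energy Q p (R / \<rho>\<^sup>2) f)"
  define \<gamma> where "\<gamma> = (1 - \<rho>) powr q * (1 - \<rho>) ^ ?n"
  define b where "b = \<rho> powr (?n * p) * (\<rho> powr (p - 1) * (\<rho> powr p - (1 - \<rho>)))"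
  have b: "b \<ge> 0"
    using \<rho> by (simp add: b_def)
  \<comment> \<open>Strict because \<open>K > 0\<close>; it yields an \<open>f\<close> that is
    extremal up to the factor \<open>\<rho>\<close>.\<close>
  have "\<rho> * K < enn2real (best_const Q p q R)"
    using \<rho> K by simp
  then obtain f where f: "f \<in> D" "(\<rho> * K) powr p * mass f powr (p / q) < enn2real (energy Q p R f)"
    using near_extremiser[OF Qm pq R, of "\<rho> * K"] \<rho> K by auto
  have f': "\<rho> powr p * K powr p * mass f powr (p / q) \<le> enn2real (energy Q p R f)"
    using f(2) \<rho> K by (simp add: powr_mult)
  have m: "mass f > 0"
  proof (rule ccontr)
    assume "\<not> ?thesis"
    then have "mass f = 0"
      using mass_nonneg[of f] by simp
    then show False
      using energy_le_mass[OF Qm f(1) pq(1) R] f(2) by simp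
  qed
  define d where "d = \<rho> ^ ?n * (1 - (1 - \<rho>) powr q) * mass f"
  have q1: "(1 - \<rho>) powr q < 1"
    using \<rho> pq powr_less_mono2[of q "1 - \<rho>" 1] by simp
  have d: "d > 0"
    using \<rho> m q1 by (simp add: d_def)
  \<comment> \<open>State after \<open>k\<close> copies. The lower mass bound forces termination,
    the upper one controls the denominator of the quotient, and the energy grows linearly in
    \<open>k\<close>.\<close>
  define inv where "inv k g \<longleftrightarrow> g \<in> D \<and> real k * d \<le> mass g \<and> mass g \<le> real k * (\<rho> ^ ?n * mass f) \<and>
      real k * (b * (K powr p * mass f powr (p / q))) \<le> ?e g" for k and g :: "real^'n \<Rightarrow> complex"
  have \<gamma>: "\<gamma> > 0"
    using \<rho> by (simp add: \<gamma>_def)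
  \<comment> \<open>Either the threshold has been passed at some stage, or
    \<open>add_copy_step\<close> still applies.\<close>
  have ex: "(\<exists>j g. inv j g \<and> mass g > \<gamma>) \<or> (\<exists>g. inv k g)" for k
  proof (induction k)
    case 0
    have "inv 0 (\<lambda>_. 0)"
      by (simp add: inv_def D_def mass_def)
    then show ?case by blast
  next
    case (Suc k)
    show ?case
    proof (cases "\<exists>j g. inv j g \<and> mass g > \<gamma>")
      case False
      with Suc obtain g where g: "inv k g" "mass g \<le> \<gamma>"
        by (meson not_le)
      then have gD: "g \<in> D" by (simp add: inv_def)
      obtain g' where g': "g' \<in> D" "mass g + d \<le> mass g'" "mass g' \<le> mass g + \<rho> ^ ?n * mass f"
        "?e g + b * (K powr p * mass f powr (p / q)) \<le> ?e g'"
        using add_copy_step[OF Q pq R \<rho>(1,2) K(1) f(1) f' gD] g(2)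
        unfolding \<gamma>_def[symmetric] d_def[symmetric] b_def[symmetric] by blast
      have "inv (Suc k) g'"
        using g(1) g' by (simp add: inv_def ring_distribs)
      then show ?thesis by blast
    qed blast
  qed
  have "\<exists>j g. inv j g \<and> mass g > \<gamma>"
  proof -
    obtain k :: nat where "\<gamma> < real k * d"
      using reals_Archimedean3[OF d] by blast
    then show ?thesis
      using ex[of k] by (auto simp: inv_def intro: less_le_trans)
  qed
  then obtain j g where g: "inv j g" "mass g > \<gamma>"
    by blast
  \<comment> \<open>Zero copies have mass 0, below the threshold; \<open>j \<ge> 1\<close> is what
    makes powers of \<open>j\<close> increasing in the exponent.\<close>
  have j: "j \<ge> 1"
    using g \<gamma> by (cases j) (auto simp: inv_def)
  have "mass g powr (p / q) \<le> (real j * mass f) powr (p / q)"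
  proof (intro powr_mono2)
    have "mass g \<le> real j * (\<rho> ^ ?n * mass f)"
      using g by (simp add: inv_def)
    also have "\<dots> \<le> real j * (1 * mass f)"
      using \<rho> by (intro mult_left_mono mult_right_mono) (auto simp: mass_nonneg power_le_one)
    finally show "mass g \<le> real j * mass f" by simp
  qed (use pq in \<open>auto simp: mass_nonneg\<close>)
  also have "\<dots> = real j powr (p / q) * mass f powr (p / q)"
    by (simp add: powr_mult)
  \<comment> \<open>Here \<open>p \<le> q\<close> enters: the norm on the right grows no faster than
    the energy gained from \<open>j\<close> copies.\<close>
  also have "\<dots> \<le> real j powr 1 * mass f powr (p / q)"
    using j pq by (intro mult_right_mono powr_mono) auto
  finally have "b * (K powr p * mass g powr (p / q)) \<le> b * (K powr p * (real j * mass f powr (p / q)))"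
    using b j by (intro mult_left_mono) auto
  also have "\<dots> = real j * (b * (K powr p * mass f powr (p / q)))"
    by simp
  also have "\<dots> \<le> ?e g"
    using g by (simp add: inv_def)
  finally show ?thesis
    using g unfolding b_def[symmetric] \<gamma>_def[symmetric]
    by (intro bexI[of _ g]) (auto simp: inv_def)
qed

section \<open>Choice of the ratio and conclusion\<close>

lemma exists_ratio:
  fixes p \<epsilon> :: real and n :: nat
  assumes "p \<ge> 2" "0 < \<epsilon>" "\<epsilon> < 1"
  shows "\<exists>\<rho>. 0 < \<rho> \<and> \<rho> < 1 \<and> 1 - \<rho> \<le> \<rho> powr p \<and> 1 / \<rho>\<^sup>2 \<le> 1 + \<epsilon> \<and>
    (1 - \<epsilon>) powr p \<le> \<rho> powr (n * p) * (\<rho> powr (p - 1) * (\<rho> powr p - (1 - \<rho>)))"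
proof -
  \<comment> \<open>All requirements except \<open>\<rho> < 1\<close> hold with room to spare in the
    limit \<open>\<rho> = 1\<close>, so they hold eventually as 1 is approached from the
    left.\<close>
  have t: "((\<lambda>\<rho>::real. \<rho>) \<longlongrightarrow> 1) (at_left 1)"
    by (rule tendsto_ident_at)
  have 1: "\<forall>\<^sub>F \<rho>::real in at_left 1. 0 < \<rho>"
    using order_tendstoD(1)[OF t, of 0] by simp
  have 2: "\<forall>\<^sub>F \<rho>::real in at_left 1. \<rho> < 1"
    by (simp add: eventually_at_filter)
  have "((\<lambda>\<rho>::real. \<rho> powr p - (1 - \<rho>)) \<longlongrightarrow> 1 powr p - (1 - 1)) (at_left 1)"
    by (intro tendsto_intros t) simp
  then have 3: "\<forall>\<^sub>F \<rho>::real in at_left 1. 0 < \<rho> powr p - (1 - \<rho>)"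
    by (rule order_tendstoD) simp
  have "((\<lambda>\<rho>::real. 1 / \<rho>\<^sup>2) \<longlongrightarrow> 1 / 1\<^sup>2) (at_left 1)"
    by (intro tendsto_intros t) simp
  then have 4: "\<forall>\<^sub>F \<rho>::real in at_left 1. 1 / \<rho>\<^sup>2 < 1 + \<epsilon>"
    by (rule order_tendstoD) (use assms in simp)
  have "((\<lambda>\<rho>::real. \<rho> powr (n * p) * (\<rho> powr (p - 1) * (\<rho> powr p - (1 - \<rho>))))
      \<longlongrightarrow> 1 powr (n * p) * (1 powr (p - 1) * (1 powr p - (1 - 1)))) (at_left 1)"
    by (intro tendsto_intros t) auto
  moreover have "(1 - \<epsilon>) powr p < 1"
    using assms powr_less_mono2[of p "1 - \<epsilon>" 1] by simp
  ultimately have 5: "\<forall>\<^sub>F \<rho>::real in at_left 1. (1 - \<epsilon>) powr p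
      < \<rho> powr (n * p) * (\<rho> powr (p - 1) * (\<rho> powr p - (1 - \<rho>)))"
    by (intro order_tendstoD) simp_all
  from 1 2 3 4 5 have "\<forall>\<^sub>F \<rho>::real in at_left 1. 0 < \<rho> \<and> \<rho> < 1 \<and> 1 - \<rho> \<le> \<rho> powr p \<and> 1 / \<rho>\<^sup>2 \<le> 1 + \<epsilon> \<and>
    (1 - \<epsilon>) powr p \<le> \<rho> powr (n * p) * (\<rho> powr (p - 1) * (\<rho> powr p - (1 - \<rho>)))"
    by eventually_elim auto
  then show ?thesis
    by (rule eventually_happens'[rotated]) simp
qed

lemma scaleR_T:
  assumes "c > 0"
  shows "(*\<^sub>R) c ` (T R :: ((real^'n) \<times> real) set) = T (c * R)"
proof (intro equalityI subsetI)
  fix z :: "(real^'n) \<times> real" assume "z \<in> T (c * R)"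
  then have "z /\<^sub>R c \<in> T R" "z = c *\<^sub>R (z /\<^sub>R c)"
    using assms by (auto simp: T_def field_simps)
  then show "z \<in> (*\<^sub>R) c ` T R" by blast
next
  fix z :: "(real^'n) \<times> real" assume "z \<in> (*\<^sub>R) c ` T R"
  then obtain y where "y \<in> T R" "z = c *\<^sub>R y"
    by blast
  moreover obtain x t where "y = (x, t)"
    by force
  ultimately have "z = (c *\<^sub>R x, c * t)" "- R \<le> t" "t \<le> R"
    by (auto simp: T_def)
  moreover from this have "c * - R \<le> c * t" "c * t \<le> c * R"
    using assms mult_left_mono[of "- R" t c] mult_left_mono[of t R c] by auto
  ultimately show "z \<in> T (c * R)"
    by (simp add: T_def)
qed

theorem corollary3p4:
  fixes Q :: "real^'n \<Rightarrow> real" and p q \<epsilon> :: real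
  assumes "quadratic_form Q"
    and "(2 * real CARD('n) + 2) / real CARD('n) \<le> p"
    and "p \<le> q"
    and "\<epsilon> > 0"
  shows "\<exists>\<gamma>>0. \<forall>R\<ge>1. \<exists>f\<in>D.
           measure lebesgue {\<xi>\<in>Omega. f \<xi> \<noteq> 0} \<ge> \<gamma> \<and>
           Lp_norm p (lebesgue_on ((*\<^sub>R) (1 + \<epsilon>) ` T R)) (extension_op Q f)
             \<ge> ennreal (1 - \<epsilon>) * best_const Q p q R * Lp_norm q (lebesgue_on Omega) f"
proof -
  have p: "p \<ge> 2"
  proof -
    have "2 \<le> (2 * real CARD('n) + 2) / real CARD('n)"
      by (simp add: field_simps)
    then show ?thesis using assms(2) by linarith
  qed
  have Qm: "Q \<in> borel_measurable borel"
    using quadratic_form_continuous[OF assms(1)] by (rule borel_measurable_continuous_onI)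
  have one: "(\<lambda>_. 1) \<in> (D :: (real^'n \<Rightarrow> complex) set)"
    "measure lebesgue {\<xi>\<in>(Omega :: (real^'n) set). (1::complex) \<noteq> 0} = 1"
    by (simp_all add: D_def measure_Omega)
  show ?thesis
  proof (cases "\<epsilon> < 1")
    \<comment> \<open>The factor \<open>1 - \<epsilon>\<close> is nonpositive and
      \<open>ennreal\<close> truncates it to 0, so the constant function 1 suffices.\<close>
    case False
    then have "ennreal (1 - \<epsilon>) = 0"
      by (simp add: ennreal_neg)
    then show ?thesis
      using one by (intro exI[of _ 1]) (auto intro!: bexI[of _ "\<lambda>_. 1"])
  next
    case True
    obtain \<rho> where \<rho>: "0 < \<rho>" "\<rho> < 1" "1 - \<rho> \<le> \<rho> powr p" "1 / \<rho>\<^sup>2 \<le> 1 + \<epsilon>"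
      "(1 - \<epsilon>) powr p \<le> \<rho> powr (CARD('n) * p) * (\<rho> powr (p - 1) * (\<rho> powr p - (1 - \<rho>)))"
      using exists_ratio[OF p assms(4) True] by blast
    \<comment> \<open>Depends on \<open>\<rho>\<close>, \<open>q\<close> and the dimension only,
      hence fixed before \<open>R\<close>. The bound by 1 that follows admits the constant function
      1 when the best constant is 0.\<close>
    define \<gamma> where "\<gamma> = (1 - \<rho>) powr q * (1 - \<rho>) ^ CARD('n)"
    have "\<gamma> \<le> 1 * 1"
      unfolding \<gamma>_def using \<rho> p assms(3) by (intro mult_mono) (auto simp: powr_le1 power_le_one)
    have "\<exists>f\<in>D. \<gamma> \<le> measure lebesgue {\<xi>\<in>Omega. f \<xi> \<noteq> 0} \<and>
        ennreal (1 - \<epsilon>) * best_const Q p q R * Lp_norm q (lebesgue_on Omega) f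
          \<le> Lp_norm p (lebesgue_on ((*\<^sub>R) (1 + \<epsilon>) ` T R)) (extension_op Q f)" if "R \<ge> 1" for R
    proof (cases "best_const Q p q R = 0")
      case True
      then show ?thesis
        using one \<open>\<gamma> \<le> 1 * 1\<close> by (intro bexI[of _ "\<lambda>_. 1"]) auto
    next
      case False
      have R: "R \<ge> 0" using that by simp
      define K where "K = enn2real (best_const Q p q R)"
      have bK: "best_const Q p q R = ennreal K"
        using best_const_finite[OF Qm p assms(3) R] by (simp add: K_def)
      have K: "K > 0"
        using False bK by (cases "K > 0") (auto simp: ennreal_neg)
      obtain g where g: "g \<in> D" "mass g \<ge> \<gamma>"
        "\<rho> powr (CARD('n) * p) * (\<rho> powr (p - 1) * (\<rho> powr p - (1 - \<rho>))) * (K powr p * mass g powr (p / q))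
           \<le> enn2real (energy Q p (R / \<rho>\<^sup>2) g)"
        using large_support_extremiser[OF assms(1) p assms(3) R \<rho>(1-3) K_def K]
        unfolding \<gamma>_def[symmetric] by blast
      have R': "(1 + \<epsilon>) * R \<ge> 0"
        using R assms(4) by simp
      have "((1 - \<epsilon>) * K) powr p * mass g powr (p / q) = (1 - \<epsilon>) powr p * (K powr p * mass g powr (p / q))"
        using True K by (simp add: powr_mult)
      also have "\<dots> \<le> \<rho> powr (CARD('n) * p) * (\<rho> powr (p - 1) * (\<rho> powr p - (1 - \<rho>))) * (K powr p * mass g powr (p / q))"
        by (intro mult_right_mono \<rho>) simp
      also note g(3)
      \<comment> \<open>The slab enlarged by the parabolic scaling fits into the dilated one, since
        \<open>1 / \<rho>\<^sup>2 \<le> 1 + \<epsilon>\<close>.\<close>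
      also have "enn2real (energy Q p (R / \<rho>\<^sup>2) g) \<le> enn2real (energy Q p ((1 + \<epsilon>) * R) g)"
      proof (rule enn2real_mono[OF energy_mono])
        show "R / \<rho>\<^sup>2 \<le> (1 + \<epsilon>) * R"
          using mult_right_mono[OF \<rho>(4) R] by simp
        show "energy Q p ((1 + \<epsilon>) * R) g < top"
          using energy_finite[OF Qm g(1) p R'] by simp
      qed
      finally have fin: "((1 - \<epsilon>) * K) powr p * mass g powr (p / q) \<le> enn2real (energy Q p ((1 + \<epsilon>) * R) g)" .
      have "mass g powr (1 / q) * ((1 - \<epsilon>) * K) = (((1 - \<epsilon>) * K) powr p * mass g powr (p / q)) powr (1 / p)"
        using p \<open>\<epsilon> < 1\<close> K by (simp add: powr_mult powr_powr)
      also have "\<dots> \<le> enn2real (energy Q p ((1 + \<epsilon>) * R) g) powr (1 / p)"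
        using fin p by (intro powr_mono2) auto
      finally have "ennreal ((1 - \<epsilon>) * K * mass g powr (1 / q)) \<le> ennreal (enn2real (energy Q p ((1 + \<epsilon>) * R) g) powr (1 / p))"
        by (intro ennreal_leI) (simp add: mult.commute)
      moreover have "ennreal (1 - \<epsilon>) * best_const Q p q R * Lp_norm q (lebesgue_on Omega) g
          = ennreal ((1 - \<epsilon>) * K * mass g powr (1 / q))"
        using \<open>\<epsilon> < 1\<close> K p assms(3) by (simp add: bK Lp_norm_D[OF g(1)] ennreal_mult)
      moreover have "Lp_norm p (lebesgue_on ((*\<^sub>R) (1 + \<epsilon>) ` T R)) (extension_op Q g)
          = ennreal (enn2real (energy Q p ((1 + \<epsilon>) * R) g) powr (1 / p))"
        using assms(4) by (simp add: scaleR_T Lp_norm_extension_op[OF energy_finite[OF Qm g(1) p R']])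
      ultimately show ?thesis
        using g(1,2) unfolding mass_def by auto
    qed
    moreover have "\<gamma> > 0"
      using \<rho> by (simp add: \<gamma>_def)
    ultimately show ?thesis by blast
  qed
qed

end
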